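(* Let $h:\mathbb T\to\mathbb T$ be an orientation-preserving homeomorphism fixing $-1,\mathrm i,1$ whose shear coordinate satisfies $s_h\in\mathcal P_0$ (this implies that $h$ is differentiable at every $v\in V$). Then the diamond shear coordinate $\vartheta_h=\Psi(s_h)$ of $h$ is given by $$\vartheta_h(e)=\frac12\log h'(a)h'(b)-\log\frac{h(a)-h(b)}{a-b}$$ for all $e=(a,b)\in E$.
   Context: Farey tessellation: $\mathbb D$ is the unit disk with its hyperbolic metric, $\mathbb T=\partial\mathbb D$, and for $a\ne b\in\mathbb T$, $(a,b)$ denotes the unoriented hyperbolic geodesic with endpoints $a,b$. The Farey tessellation $\mathfrak F$ is the ideal triangulation of $\mathbb D$ obtained from the ideal triangle with vertices $1,\mathrm i,-1$ by repeated hyperbolic reflections across edges. $V$ is its vertex set, $E$ its edge set. For $e\in E$, the Farey quad $Q_e$ is the union of the two triangles of $\mathfrak F$ having $e$ as an edge; write its vertices counterclockwise as $(a,b,c,d)$ with $e=(a,c)$. For $v\in V$, $\mathrm{fan}(v)$ is the set of edges incident to $v$, indexed $(e_n)_{n\in\mathbb Z}$ so that under a Möbius map $\mathbb D\to\mathbb H$ sending $v$ to $\infty$ the $e_n$ become equally spaced vertical lines with $n$ increasing from left to right (the choice of $e_0$ is arbitrary). Shears: for a circle homeomorphism $h$ (orientation preserving, fixing $-1,\mathrm i,1$) the shear coordinate $s_h:E\to\mathbb R$ is $s_h(e)=\log\mathrm{cr}(h(a),h(b),h(c),h(d))$, where $Q_e=(a,b,c,d)$, $e=(a,c)$ and $\mathrm{cr}(a,b,c,d)=\frac{(b-a)(d-c)}{(c-b)(d-a)}$.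 $\mathcal P$ is the set of $s:E\to\mathbb R$ such that for every $v\in V$ with $\mathrm{fan}(v)=(e_n)_{n\in\mathbb Z}$ both limits $\lim_{n\to\infty}\sum_{k=-n}^{-1}s(e_k)$ and $\lim_{n\to\infty}\sum_{k=0}^n s(e_k)$ exist in $\mathbb R$; $\mathcal P_0\subset\mathcal P$ is the subset where moreover $\sum_{k=-\infty}^\infty s(e_k)=0$ for every $v\in V$. For $s\in\mathcal P$, $v\in V$, $e\in\mathrm{fan}(v)$, let $p_{s,v}(e+)$ (resp. $p_{s,v}(e-)$) be the sum of $s(e')$ over $e'\in\mathrm{fan}(v)$ of strictly larger (resp. strictly smaller) index than $e$. For $e=(a,b)\in E$ put $$\Psi(s)(e)=\tfrac14\big(p_{s,a}(e-)-p_{s,a}(e+)+p_{s,b}(e-)-p_{s,b}(e+)\big).$$ The diamond shear coordinate of $h$ with $s_h\in\mathcal P$ is $\vartheta_h=\Psi(s_h)$. In the formula, $h'(a)$ is the derivative along the circle, $h'(a)=\lim_{z\to a,\,z\in\mathbb T}(h(z)-h(a))/(z-a)$. The quantity $h'(a)h'(b)(a-b)^2/(h(a)-h(b))^2$ is a positive real number and the right-hand side is understood as one half of its real logarithm, i.e. $\frac12\log|h'(a)h'(b)|-\log\left|\frac{h(a)-h(b)}{a-b}\right|$. *)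

theory Defs
  imports "HOL-Analysis.Analysis"
begin

text \<open>
  The circle is \<^term>\<open>sphere (0::complex) 1\<close>. A geodesic of the disk is represented by its set
  \<open>{a, b}\<close> of endpoints, an ideal triangle by its set \<open>{a, b, c}\<close> of ideal vertices.
\<close>

text \<open>
  Reflection across the geodesic with endpoints \<open>a\<close> and \<open>b\<close>. For \<open>a + b \<noteq> 0\<close> it is the inversion
  \<open>z \<mapsto> p + (\<bar>p\<bar>\<^sup>2 - 1) / cnj (z - p)\<close> in the circle orthogonal to the unit circle, centred at
  \<open>p = 2ab / (a + b)\<close>; for \<open>b = -a\<close> it is the Euclidean reflection \<open>z \<mapsto> a\<^sup>2 cnj z\<close>.
  The formula below covers both cases.
\<close>
definition hyp_reflection :: "complex \<Rightarrow> complex \<Rightarrow> complex \<Rightarrow> complex" where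
  "hyp_reflection a b z = (2 * a * b * cnj z - (a + b)) / ((a + b) * cnj z - 2)"

inductive_set farey_triangles :: "complex set set" where
  base: "{1, \<i>, -1} \<in> farey_triangles"
| reflect: "T \<in> farey_triangles \<Longrightarrow> a \<in> T \<Longrightarrow> b \<in> T \<Longrightarrow> a \<noteq> b \<Longrightarrow>
    hyp_reflection a b ` T \<in> farey_triangles"

definition farey_vertices :: "complex set" where
  "farey_vertices = \<Union> farey_triangles"

definition farey_edges :: "complex set set" where
  "farey_edges = {{a, b} |a b. a \<noteq> b \<and> (\<exists>T\<in>farey_triangles. a \<in> T \<and> b \<in> T)}"

definition ccw :: "complex list \<Rightarrow> bool" where
  "ccw zs \<longleftrightarrow>
    (\<exists>ts. zs = map cis ts \<and> sorted_wrt (<) ts \<and> last ts < hd ts + 2 * pi)"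

definition orientation_preserving :: "(complex \<Rightarrow> complex) \<Rightarrow> bool" where
  "orientation_preserving h \<longleftrightarrow> (\<forall>a b c. ccw [a, b, c] \<longrightarrow> ccw [h a, h b, h c])"

definition farey_quad :: "complex set \<Rightarrow> complex \<Rightarrow> complex \<Rightarrow> complex \<Rightarrow> complex \<Rightarrow> bool" where
  "farey_quad e a b c d \<longleftrightarrow>
    e = {a, c} \<and> {a, b, c} \<in> farey_triangles \<and> {a, c, d} \<in> farey_triangles \<and> ccw [a, b, c, d]"

definition cr :: "complex \<Rightarrow> complex \<Rightarrow> complex \<Rightarrow> complex \<Rightarrow> complex" where
  "cr a b c d = ((b - a) * (d - c)) / ((c - b) * (d - a))"

text \<open>
  The cross ratio of four counterclockwise points of the circle is a positive real. An edge has
  exactly two labellings, \<open>(a, b, c, d)\<close> and \<open>(c, d, a, b)\<close>, with the same cross ratio.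
\<close>
definition shear :: "(complex \<Rightarrow> complex) \<Rightarrow> complex set \<Rightarrow> real" where
  "shear h e =
    (THE x. \<exists>a b c d. farey_quad e a b c d \<and> x = ln (Re (cr (h a) (h b) (h c) (h d))))"

definition fan :: "complex \<Rightarrow> complex set set" where
  "fan v = {e \<in> farey_edges. v \<in> e}"

text \<open>
  A Moebius map from the disk to the upper half plane sending \<open>v\<close> to infinity. Any other one
  differs from it by a map \<open>x \<mapsto> \<lambda> * x + \<mu>\<close> with \<open>\<lambda> > 0\<close> and \<open>\<mu>\<close> real, so
  the notion of fan indexing below does not depend on this choice.
\<close>
definition cayley :: "complex \<Rightarrow> complex \<Rightarrow> complex" where
  "cayley v z = \<i> * (v + z) / (v - z)"

definition fan_indexing :: "complex \<Rightarrow> (int \<Rightarrow> complex set) \<Rightarrow> bool" where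
  "fan_indexing v f \<longleftrightarrow>
    bij_betw f UNIV (fan v) \<and>
    (\<exists>x0 \<delta>::real. \<delta> > 0 \<and>
      (\<forall>n. \<exists>w. w \<noteq> v \<and> f n = {v, w} \<and> cayley v w = of_real (x0 + of_int n * \<delta>)))"

text \<open>
  Functions on edges are total functions on \<^typ>\<open>complex set\<close>; only their values on
  \<^const>\<open>farey_edges\<close> matter.
\<close>
definition shear_P :: "(complex set \<Rightarrow> real) set" where
  "shear_P = {s. \<forall>v\<in>farey_vertices. \<forall>f. fan_indexing v f \<longrightarrow>
     convergent (\<lambda>n::nat. \<Sum>k\<in>{- int n..-1}. s (f k)) \<and>
     convergent (\<lambda>n::nat. \<Sum>k\<in>{0..int n}. s (f k))}"

definition shear_P0 :: "(complex set \<Rightarrow> real) set" where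
  "shear_P0 = {s \<in> shear_P. \<forall>v\<in>farey_vertices. \<forall>f. fan_indexing v f \<longrightarrow>
     lim (\<lambda>n::nat. \<Sum>k\<in>{- int n..-1}. s (f k)) + lim (\<lambda>n::nat. \<Sum>k\<in>{0..int n}. s (f k)) = 0}"

text \<open>The indexing of the fan of \<open>v\<close> is unique once the edge \<open>e\<close> of index \<open>0\<close> is prescribed.\<close>
definition fan_from :: "complex \<Rightarrow> complex set \<Rightarrow> int \<Rightarrow> complex set" where
  "fan_from v e = (THE f. fan_indexing v f \<and> f 0 = e)"

definition p_plus :: "(complex set \<Rightarrow> real) \<Rightarrow> complex \<Rightarrow> complex set \<Rightarrow> real" where
  "p_plus s v e = lim (\<lambda>n::nat. \<Sum>k\<in>{1..int n}. s (fan_from v e k))"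

definition p_minus :: "(complex set \<Rightarrow> real) \<Rightarrow> complex \<Rightarrow> complex set \<Rightarrow> real" where
  "p_minus s v e = lim (\<lambda>n::nat. \<Sum>k\<in>{- int n..-1}. s (fan_from v e k))"

definition Psi :: "(complex set \<Rightarrow> real) \<Rightarrow> complex set \<Rightarrow> real" where
  "Psi s e = 1 / 4 * (\<Sum>v\<in>e. p_minus s v e - p_plus s v e)"

definition diamond_shear :: "(complex \<Rightarrow> complex) \<Rightarrow> complex set \<Rightarrow> real" where
  "diamond_shear h = Psi (shear h)"

definition circle_deriv :: "(complex \<Rightarrow> complex) \<Rightarrow> complex \<Rightarrow> complex" where
  "circle_deriv h a = Lim (at a within sphere 0 1) (\<lambda>z. (h z - h a) / (z - a))"

end

theory Submission imports Defs begin

text \<open>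
  In a half plane chart at a vertex \<open>v\<close>, the edges of the fan of \<open>v\<close> become equally spaced vertical
  lines, with gap \<open>\<delta>\<close> say, and \<open>h\<close> maps them to vertical lines with abscissas \<open>y n\<close>. The
  shear of the \<open>n\<close>-th edge is the logarithm of the ratio of the consecutive gaps
  \<open>y (n + 1) - y n\<close> and \<open>y n - y (n - 1)\<close>, so partial sums of shears telescope, and the
  \<open>P\<^sub>0\<close> condition says that the gaps tend to one limit \<open>D > 0\<close> at both ends. By
  monotonicity the chart expression of \<open>h\<close> then grows linearly with slope \<open>D / \<delta>\<close> near
  infinity, which makes \<open>h\<close> differentiable at \<open>v\<close> with \<open>|h'(v)| = \<delta> / D\<close>. At an edge
  \<open>(a, b)\<close>, \<open>\<Psi>\<close> involves only \<open>D\<close> at the two ends and the four gaps adjacent to the edge,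
  whose product is \<open>16 / |h(a) - h(b)|\<^sup>4\<close>.
\<close>

section \<open>Arithmetic of the Farey tessellation\<close>

text \<open>
  The vertices are the points \<open>w / cnj w\<close> for primitive Gaussian integers \<open>w = q + p\<i>\<close>; this is
  the image of the rational \<open>p / q\<close> under the Moebius map taking \<open>0, 1, \<infinity>\<close> to \<open>1, \<i>, -1\<close>.
\<close>

definition vtx :: "complex \<Rightarrow> complex" where
  "vtx w = w / cnj w"

definition gauss_int :: "complex \<Rightarrow> bool" where
  "gauss_int w \<longleftrightarrow> Re w \<in> \<int> \<and> Im w \<in> \<int>"

text \<open>\<open>Im (cnj u * w)\<close> is the determinant of \<open>u\<close> and
  \<open>w\<close> as integer vectors, so the last condition is the Farey neighbour condition for
  two fractions; it also makes \<open>u\<close> and \<open>w\<close> primitive.\<close>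

definition unimodular :: "complex \<Rightarrow> complex \<Rightarrow> bool" where
  "unimodular u w \<longleftrightarrow> gauss_int u \<and> gauss_int w \<and> \<bar>Im (cnj u * w)\<bar> = 1"

section \<open>Determinants and primitive lifts of vertices\<close>

lemma gauss_int_minus: "gauss_int u \<Longrightarrow> gauss_int (- u)"
  and gauss_int_add: "gauss_int u \<Longrightarrow> gauss_int w \<Longrightarrow> gauss_int (u + w)"
  and gauss_int_diff: "gauss_int u \<Longrightarrow> gauss_int w \<Longrightarrow> gauss_int (u - w)"
  and gauss_int_scale: "gauss_int u \<Longrightarrow> gauss_int (of_int n * u)"
  by (auto simp: gauss_int_def)

lemma gauss_int_det: "gauss_int u \<Longrightarrow> gauss_int w \<Longrightarrow> Im (cnj u * w) \<in> \<int>"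
  by (auto simp: gauss_int_def)

lemma vtx_minus [simp]: "vtx (- w) = vtx w"
  by (simp add: vtx_def)

lemma norm_vtx: "w \<noteq> 0 \<Longrightarrow> norm (vtx w) = 1"
  by (simp add: vtx_def norm_divide)

lemma unimodular_nz: "unimodular u w \<Longrightarrow> u \<noteq> 0" "unimodular u w \<Longrightarrow> w \<noteq> 0"
  by (auto simp: unimodular_def)

lemma unimodular_sym: "unimodular u w \<Longrightarrow> unimodular w u"
  by (auto simp: unimodular_def abs_if algebra_simps split: if_splits)

lemma unimodular_minus1: "unimodular u w \<Longrightarrow> unimodular (- u) w"
  and unimodular_minus2: "unimodular u w \<Longrightarrow> unimodular u (- w)"
  by (auto simp: unimodular_def gauss_int_minus abs_if algebra_simps split: if_splits)

text \<open>\<open>cnj u * u\<close> is real, so the determinant does not change; this moves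
  \<open>w\<close> along the fan of \<open>vtx u\<close>.\<close>

lemma unimodular_shear: "unimodular u w \<Longrightarrow> unimodular u (w + of_int n * u)"
proof -
  have "Im (cnj u * (w + of_int n * u)) = Im (cnj u * w)" by (simp add: algebra_simps)
  then show "unimodular u w \<Longrightarrow> unimodular u (w + of_int n * u)"
    by (simp add: unimodular_def gauss_int_add gauss_int_scale)
qed

lemma vtx_eq_iff:
  assumes "u \<noteq> 0" "w \<noteq> 0"
  shows "vtx u = vtx w \<longleftrightarrow> Im (cnj u * w) = 0"
proof -
  have "vtx u = vtx w \<longleftrightarrow> u * cnj w = w * cnj u"
    using assms by (simp add: vtx_def field_simps)
  also have "\<dots> \<longleftrightarrow> Im (cnj u * w) = 0"
    by (auto simp: complex_eq_iff algebra_simps)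
  finally show ?thesis .
qed

lemma unimodular_vtx_neq: "unimodular u w \<Longrightarrow> vtx u \<noteq> vtx w"
  using vtx_eq_iff[OF unimodular_nz] by (auto simp add: unimodular_def)

text \<open>Cramer's rule in the basis \<open>u\<close>, \<open>w\<close>: the coefficient is an
  integer because the determinant is 1 or -1.\<close>

lemma det_zero_imp_multiple:
  assumes "unimodular u w" "gauss_int u'" "Im (cnj u * u') = 0"
  obtains n :: int where "u' = of_int n * u"
proof -
  let ?d = "Im (cnj u * w)" and ?m = "Im (cnj u' * w)"
  have "of_real ?d * u' = of_real ?m * u"
    using assms(3) by (auto simp: complex_eq_iff algebra_simps)
  moreover have "?d = 1 \<or> ?d = -1"
    using assms(1) by (auto simp: unimodular_def)
  ultimately have "u' = of_real (?d * ?m) * u"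
    by (metis minus_minus mult_1 mult_minus1 of_real_1 of_real_minus mult.assoc of_real_mult)
  moreover have "?d * ?m \<in> \<int>"
    using assms by (intro Ints_mult gauss_int_det) (auto simp: unimodular_def)
  ultimately show ?thesis
    using that by (metis Ints_cases of_real_of_int_eq)
qed

text \<open>Each of \<open>u\<close> and \<open>u'\<close> is an integer multiple of the other, so
  primitive lifts are unique up to sign. The partners \<open>w\<close> and \<open>w'\<close> certify
  primitivity.\<close>

lemma vtx_inj:
  assumes "unimodular u w" "unimodular u' w'" "vtx u = vtx u'"
  shows "u' = u \<or> u' = - u"
proof -
  have z: "Im (cnj u * u') = 0"
    using assms vtx_eq_iff unimodular_nz by blast
  then have z': "Im (cnj u' * u) = 0" by (simp add: algebra_simps)
  have g: "gauss_int u" "gauss_int u'" using assms by (auto simp: unimodular_def)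
  obtain n where n: "u' = of_int n * u"
    using det_zero_imp_multiple[OF assms(1) g(2) z] .
  obtain m where m: "u = of_int m * u'"
    using det_zero_imp_multiple[OF assms(2) g(1) z'] .
  have "u = of_int (m * n) * u" using m n by simp
  then have "of_int (m * n) = (1::complex)"
    using unimodular_nz(1)[OF assms(1)] by simp
  then have "m * n = 1" using of_int_eq_1_iff by blast
  then have "n = 1 \<or> n = -1" using zmult_eq_1_iff by auto
  then show ?thesis using n by auto
qed

text \<open>On lifts, the reflection across an edge becomes the linear map fixing \<open>u\<close>
  and negating \<open>w\<close>, so the tessellation can be followed by integer arithmetic.\<close>

lemma hyp_reflection_vtx:
  assumes "unimodular u w" and nz: "of_real s * u + of_real t * w \<noteq> 0"
  shows "hyp_reflection (vtx u) (vtx w) (vtx (of_real s * u + of_real t * w)) =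
    vtx (of_real s * u - of_real t * w)"
proof -
  define z where "z = of_real s * u + of_real t * w"
  define z' where "z' = of_real s * u - of_real t * w"
  have nz': "u \<noteq> 0" "w \<noteq> 0" "z \<noteq> 0" using assms unimodular_nz by (auto simp: z_def)
  define k where "k = w * cnj u - u * cnj w"
  have k: "cnj k = - k" by (simp add: k_def)
  have k0: "k \<noteq> 0"
    using assms(1) by (auto simp: k_def unimodular_def complex_eq_iff algebra_simps)
  \<comment> \<open>This is the numerator after clearing denominators. The denominator is minus its
    conjugate, and \<open>k\<close> is purely imaginary, so \<open>k\<close> cancels.\<close>
  have n: "2 * u * w * cnj z - (u * cnj w + w * cnj u) * z = z' * k"
    by (simp add: z_def z'_def k_def algebra_simps)
  have d: "(u * cnj w + w * cnj u) * cnj z - 2 * cnj u * cnj w * z = cnj z' * k"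
    using arg_cong[OF n, of cnj] k by (simp add: algebra_simps)
  have "hyp_reflection (vtx u) (vtx w) (vtx z) =
     (2 * u * w * cnj z - (u * cnj w + w * cnj u) * z) /
     ((u * cnj w + w * cnj u) * cnj z - 2 * cnj u * cnj w * z)"
  proof -
    have c: "cnj u \<noteq> 0" "cnj w \<noteq> 0" using nz' by auto
    \<comment> \<open>Common factor that clears the denominators of \<open>vtx u\<close>,
      \<open>vtx w\<close> and \<open>cnj (vtx z)\<close>.\<close>
    let ?f = "cnj u * cnj w * z"
    have f0: "?f \<noteq> 0" using nz' by simp
    have 1: "2 * u * w * cnj z - (u * cnj w + w * cnj u) * z =
       (2 * vtx u * vtx w * cnj (vtx z) - (vtx u + vtx w)) * ?f"
      using nz' c by (simp add: vtx_def field_simps)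
    have 2: "(u * cnj w + w * cnj u) * cnj z - 2 * cnj u * cnj w * z =
       ((vtx u + vtx w) * cnj (vtx z) - 2) * ?f"
      using nz' c by (simp add: vtx_def field_simps)
    show ?thesis unfolding 1 2 using f0 by (simp add: hyp_reflection_def)
  qed
  also have "\<dots> = vtx z'" unfolding n d using k0 by (simp add: vtx_def)
  finally show ?thesis by (simp add: z_def z'_def)
qed

text \<open>The lifts \<open>u\<close>, \<open>w\<close> and \<open>- (u + w)\<close> sum to zero
  and any two of them have determinant 1 or -1, so up to sign any ordered pair of vertices can serve
  as the first two.\<close>

lemma farey_triangle_pair_aux:
  assumes "unimodular u w" "T = {vtx u, vtx w, vtx (u + w)}" "a \<in> T" "b \<in> T" "a \<noteq> b"
  shows "\<exists>u w. unimodular u w \<and> a = vtx u \<and> b = vtx w \<and> T = {vtx u, vtx w, vtx (u + w)}"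
proof -
  have 1: "unimodular (- u) (u + w)"
    using unimodular_minus1[OF unimodular_shear[OF assms(1), of 1]] by (simp add: add.commute)
  have 2: "unimodular (- w) (u + w)"
    using unimodular_minus1[OF unimodular_shear[OF unimodular_sym[OF assms(1)], of 1]]
    by simp
  let ?P = "\<lambda>u' w'. unimodular u' w' \<and> a = vtx u' \<and> b = vtx w' \<and> T = {vtx u', vtx w', vtx (u' + w')}"
  have "?P u w \<or> ?P w u \<or> ?P (- u) (u + w) \<or> ?P (u + w) (- u) \<or> ?P (- w) (u + w) \<or> ?P (u + w) (- w)"
    using assms 1 2 unimodular_sym[OF 1] unimodular_sym[OF 2] unimodular_sym[OF assms(1)]
    by (auto simp: insert_commute add.commute[of w u])
  then show ?thesis by blast
qed

text \<open>Reflecting across the edge of \<open>u\<close> and \<open>w\<close> replaces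
  \<open>u + w\<close> by \<open>u - w\<close>, which has the same form with \<open>- w\<close> for
  \<open>w\<close>.\<close>

lemma farey_triangle_form:
  "T \<in> farey_triangles \<Longrightarrow> \<exists>u w. unimodular u w \<and> T = {vtx u, vtx w, vtx (u + w)}"
proof (induction rule: farey_triangles.induct)
  case base
  have "unimodular 1 \<i>" by (simp add: unimodular_def gauss_int_def)
  moreover have "{1, \<i>, -1} = {vtx 1, vtx \<i>, vtx (1 + \<i>)}"
    by (auto simp: vtx_def complex_eq_iff Re_divide Im_divide)
  ultimately show ?case by blast
next
  case (reflect T a b)
  then obtain u w where uw: "unimodular u w" "a = vtx u" "b = vtx w"
    "T = {vtx u, vtx w, vtx (u + w)}"
    using farey_triangle_pair_aux by meson
  have s: "u + w \<noteq> 0"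
    using unimodular_nz(2)[OF unimodular_shear[OF uw(1), of 1]] by (simp add: add.commute)
  have "hyp_reflection a b ` T = {vtx u, vtx w, vtx (u - w)}"
    using hyp_reflection_vtx[OF uw(1), of 1 0] hyp_reflection_vtx[OF uw(1), of 0 1]
      hyp_reflection_vtx[OF uw(1), of 1 1] s unimodular_nz[OF uw(1)]
    by (simp add: uw)
  then show ?case using unimodular_minus2[OF uw(1)]
    by (intro exI[of _ u] exI[of _ "- w"]) simp
qed

lemma farey_triangle_pair:
  assumes "T \<in> farey_triangles" "a \<in> T" "b \<in> T" "a \<noteq> b"
  obtains u w where "unimodular u w" "a = vtx u" "b = vtx w" "T = {vtx u, vtx w, vtx (u + w)}"
  using farey_triangle_form[OF assms(1)] farey_triangle_pair_aux assms(2-4) by meson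

lemma farey_triangle_reflect:
  assumes "unimodular u w" "{vtx u, vtx w, vtx (u + w)} \<in> farey_triangles"
  shows "{vtx u, vtx w, vtx (u - w)} \<in> farey_triangles"
proof -
  have s: "u + w \<noteq> 0"
    using unimodular_nz(2)[OF unimodular_shear[OF assms(1), of 1]] by (simp add: add.commute)
  have "hyp_reflection (vtx u) (vtx w) ` {vtx u, vtx w, vtx (u + w)} = {vtx u, vtx w, vtx (u - w)}"
    using hyp_reflection_vtx[OF assms(1), of 1 0] hyp_reflection_vtx[OF assms(1), of 0 1]
      hyp_reflection_vtx[OF assms(1), of 1 1] s unimodular_nz[OF assms(1)]
    by simp
  moreover have "hyp_reflection (vtx u) (vtx w) ` {vtx u, vtx w, vtx (u + w)} \<in> farey_triangles"
    by (rule farey_triangles.reflect[OF assms(2)]) (use unimodular_vtx_neq[OF assms(1)] in auto)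
  ultimately show ?thesis by (simp only:)
qed

text \<open>The lifts of the two ends are unique up to sign, which leaves only \<open>w + u\<close>
  and \<open>w - u\<close> for the third vertex.\<close>

lemma farey_triangle_cases:
  assumes "unimodular u w" "T \<in> farey_triangles" "vtx u \<in> T" "vtx w \<in> T"
  shows "T = {vtx u, vtx w, vtx (w + u)} \<or> T = {vtx u, vtx w, vtx (w - u)}"
proof -
  obtain u' w' where uw: "unimodular u' w'" "vtx u = vtx u'" "vtx w = vtx w'"
    "T = {vtx u', vtx w', vtx (u' + w')}"
    using farey_triangle_pair[OF assms(2,3,4) unimodular_vtx_neq[OF assms(1)]] .
  have "u' = u \<or> u' = - u" "w' = w \<or> w' = - w"
    using vtx_inj[OF assms(1) uw(1,2)]
      vtx_inj[OF unimodular_sym[OF assms(1)] unimodular_sym[OF uw(1)] uw(3)] by auto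
  then have "u' + w' \<in> {w + u, - (w + u), w - u, - (w - u)}" by auto
  then have "vtx (u' + w') = vtx (w + u) \<or> vtx (u' + w') = vtx (w - u)"
    by (metis empty_iff insert_iff vtx_minus)
  moreover have "T = {vtx u, vtx w, vtx (u' + w')}" using uw(2-4) by simp
  ultimately show ?thesis by (elim disjE) (simp_all only: simp_thms)
qed

section \<open>Edges and fans in terms of Gaussian integers\<close>

lemma farey_edgeI:
  "T \<in> farey_triangles \<Longrightarrow> a \<in> T \<Longrightarrow> b \<in> T \<Longrightarrow> a \<noteq> b \<Longrightarrow> {a, b} \<in> farey_edges"
  unfolding farey_edges_def by blast

text \<open>One triangle comes with the edge; reflecting it across the edge yields the
  other.\<close>

lemma farey_edge_triangles:
  assumes "unimodular u w" "{vtx u, vtx w} \<in> farey_edges"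
  shows "{vtx u, vtx w, vtx (w + u)} \<in> farey_triangles"
    and "{vtx u, vtx w, vtx (w - u)} \<in> farey_triangles"
proof -
  obtain T where T: "T \<in> farey_triangles" "vtx u \<in> T" "vtx w \<in> T"
    using assms(2) by (auto simp: farey_edges_def doubleton_eq_iff)
  have m: "vtx (w - u) = vtx (u - w)" using vtx_minus[of "u - w"] by simp
  from farey_triangle_cases[OF assms(1) T]
  have "{vtx u, vtx w, vtx (w + u)} \<in> farey_triangles \<and> {vtx u, vtx w, vtx (w - u)} \<in> farey_triangles"
  proof
    assume "T = {vtx u, vtx w, vtx (w + u)}"
    then show ?thesis using farey_triangle_reflect[OF assms(1)] T(1) m by (simp add: add.commute)
  next
    assume "T = {vtx u, vtx w, vtx (w - u)}"
    then show ?thesis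
      using farey_triangle_reflect[OF unimodular_minus2[OF assms(1)]] T(1) m by (simp add: add.commute)
  qed
  then show "{vtx u, vtx w, vtx (w + u)} \<in> farey_triangles"
    and "{vtx u, vtx w, vtx (w - u)} \<in> farey_triangles" by auto
qed

text \<open>Passing to the next triangle around \<open>vtx u\<close> adds or subtracts
  \<open>u\<close>; this is iterated in both directions.\<close>

lemma farey_edge_shift:
  assumes "unimodular u w" "{vtx u, vtx w} \<in> farey_edges"
  shows "{vtx u, vtx (w + of_int n * u)} \<in> farey_edges"
proof -
  have step: "{vtx u, vtx (w' + u)} \<in> farey_edges \<and> {vtx u, vtx (w' - u)} \<in> farey_edges"
    if w': "unimodular u w'" "{vtx u, vtx w'} \<in> farey_edges" for w'
  proof -
    have n: "vtx u \<noteq> vtx (w' + u)" "vtx u \<noteq> vtx (w' - u)"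
      using unimodular_vtx_neq[OF unimodular_shear[OF w'(1), of 1]]
        unimodular_vtx_neq[OF unimodular_shear[OF w'(1), of "-1"]] by auto
    show ?thesis
      using farey_edgeI[OF farey_edge_triangles(1)[OF w'], of "vtx u"]
        farey_edgeI[OF farey_edge_triangles(2)[OF w'], of "vtx u"] n by simp
  qed
  show ?thesis
  proof (induction n rule: int_induct[where k = 0])
    case base
    then show ?case using assms(2) by simp
  next
    case (step1 i)
    then show ?case using step[OF unimodular_shear[OF assms(1), of i]] by (simp add: algebra_simps)
  next
    case (step2 i)
    then show ?case using step[OF unimodular_shear[OF assms(1), of i]] by (simp add: algebra_simps)
  qed
qed

text \<open>A sign change of \<open>w\<close> does not move its vertex, so the determinant can be
  normalised to 1. This fixes the direction in which fans are indexed.\<close>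

lemma farey_edge_form:
  assumes "{a, b} \<in> farey_edges"
  obtains u w where "unimodular u w" "Im (cnj u * w) = 1" "a = vtx u" "b = vtx w"
proof -
  obtain T where "T \<in> farey_triangles" "a \<in> T" "b \<in> T" "a \<noteq> b"
    using assms by (auto simp: farey_edges_def doubleton_eq_iff)
  then obtain u w where uw: "unimodular u w" "a = vtx u" "b = vtx w"
    using farey_triangle_pair by metis
  show ?thesis
  proof (cases "Im (cnj u * w) = 1")
    case True
    then show ?thesis using that uw by blast
  next
    case False
    then have "Im (cnj u * (- w)) = 1" using uw(1) by (auto simp: unimodular_def)
    then show ?thesis using that[of u "- w"] uw unimodular_minus2 by simp
  qed
qed

lemma farey_vertex_edge:
  assumes "v \<in> farey_vertices"
  obtains b where "{v, b} \<in> farey_edges"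
proof -
  obtain T where T: "T \<in> farey_triangles" "v \<in> T" using assms by (auto simp: farey_vertices_def)
  obtain u w where uw: "unimodular u w" "T = {vtx u, vtx w, vtx (u + w)}"
    using farey_triangle_form[OF T(1)] by blast
  then have "vtx u \<in> T" "vtx w \<in> T" "vtx u \<noteq> vtx w" using unimodular_vtx_neq by auto
  then obtain b where "b \<in> T" "b \<noteq> v" by metis
  then show ?thesis using that[of b] T farey_edgeI[of T v b] by simp
qed

text \<open>Every neighbour has a lift of determinant 1 against \<open>u\<close>, and the difference
  of two such lifts has determinant 0, hence is a multiple of \<open>u\<close>. The minus sign makes
  the chart value grow with \<open>n\<close>.\<close>

lemma fan_vtx:
  assumes "unimodular u w" "{vtx u, vtx w} \<in> farey_edges" "Im (cnj u * w) = 1"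
  shows "fan (vtx u) = range (\<lambda>n::int. {vtx u, vtx (w - of_int n * u)})"
proof (intro equalityI subsetI)
  fix e assume "e \<in> fan (vtx u)"
  then obtain b where e: "e = {vtx u, b}" "e \<in> farey_edges" by (auto simp: fan_def farey_edges_def)
  obtain u' w' where uw: "unimodular u' w'" "Im (cnj u' * w') = 1" "vtx u = vtx u'" "b = vtx w'"
    using farey_edge_form[of "vtx u" b] e by metis
  obtain w'' where w'': "unimodular u w''" "Im (cnj u * w'') = 1" "b = vtx w''"
  proof (cases "u' = u")
    case True
    then show ?thesis using uw that by blast
  next
    case False
    then have "u' = - u" using vtx_inj[OF assms(1) uw(1,3)] by blast
    then show ?thesis using that[of "- w'"] uw unimodular_minus1[OF unimodular_minus2[OF uw(1)]] by simp
  qed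
  have "Im (cnj u * (w - w'')) = 0" using w''(2) assms(3) by (simp add: algebra_simps)
  moreover have "gauss_int (w - w'')"
    using assms(1) w''(1) gauss_int_diff by (auto simp: unimodular_def)
  ultimately obtain n where "w - w'' = of_int n * u"
    using det_zero_imp_multiple[OF assms(1)] by metis
  then have "w'' = w - of_int n * u" by (simp add: algebra_simps)
  then show "e \<in> range (\<lambda>n::int. {vtx u, vtx (w - of_int n * u)})" using e w'' by blast
next
  fix e assume "e \<in> range (\<lambda>n::int. {vtx u, vtx (w - of_int n * u)})"
  then obtain n :: int where "e = {vtx u, vtx (w - of_int n * u)}" by blast
  then show "e \<in> fan (vtx u)"
    using farey_edge_shift[OF assms(1,2), of "- n"] by (simp add: fan_def)
qed

section \<open>Charts and cyclic order on the circle\<close>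

text \<open>\<open>cayley a\<close> is real on the circle, so \<open>Re\<close> loses nothing there;
  at \<open>z = a\<close> division by zero gives the value 0.\<close>

definition chart :: "complex \<Rightarrow> complex \<Rightarrow> real" where
  "chart a z = Re (cayley a z)"

text \<open>With \<open>m\<close> the mean of the angles, \<open>cis s + cis t\<close> and
  \<open>cis s - cis t\<close> share the factor \<open>cis m\<close>, which cancels.\<close>

lemma cayley_cis: "cayley (cis s) (cis t) = of_real (- cot ((t - s) / 2))"
proof -
  define m d where "m = (s + t) / 2" and "d = (t - s) / 2"
  have "s = m - d" "t = m + d" by (simp_all add: m_def d_def field_simps)
  then have s: "cis s = cis m * cis (- d)" and t: "cis t = cis m * cis d"
    by (simp_all add: cis_mult)
  have n: "cis s + cis t = cis m * (2 * of_real (cos d))"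
    unfolding s t by (simp add: complex_eq_iff algebra_simps)
  have d': "cis s - cis t = cis m * (- 2 * \<i> * of_real (sin d))"
    unfolding s t by (simp add: complex_eq_iff algebra_simps)
  have "cayley (cis s) (cis t) = cis m * (\<i> * 2 * of_real (cos d)) / (cis m * (- 2 * \<i> * of_real (sin d)))"
    unfolding cayley_def n d' by simp
  also have "\<dots> = \<i> * 2 * of_real (cos d) / (- 2 * \<i> * of_real (sin d))"
    by (rule mult_divide_mult_cancel_left) simp
  also have "\<dots> = of_real (- cot d)"
    by (simp add: cot_def)
  finally show ?thesis by (simp add: d_def)
qed

lemma circle_cis: "norm z = 1 \<Longrightarrow> \<exists>t. z = cis t"
  using complex_norm_eq_1_exp[of z] by (metis cis_conv_exp)

lemma circle_cis_above:
  assumes "norm z = 1" "z \<noteq> cis s"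
  obtains t where "s < t" "t < s + 2 * pi" "z = cis t"
proof -
  let ?r = "Arg2pi (z / cis s)"
  have "z / cis s = cis ?r"
    using complex_norm_eq_1_exp[of "z / cis s"] assms by (simp add: norm_divide cis_conv_exp)
  then have z: "z = cis (s + ?r)" by (simp add: cis_mult [symmetric] field_simps)
  moreover have "0 \<le> ?r" "?r < 2 * pi" by (auto simp: Arg2pi_ge_0 Arg2pi_lt_2pi)
  moreover have "?r \<noteq> 0" using z assms(2) by auto
  ultimately show ?thesis using that[of "s + ?r"] by simp
qed

lemma cayley_eq_chart:
  assumes "norm a = 1" "norm z = 1"
  shows "cayley a z = of_real (chart a z)"
proof -
  obtain s t where "a = cis s" "z = cis t" using assms circle_cis by metis
  then show ?thesis by (simp add: chart_def cayley_cis)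
qed

lemma cot_strict_antimono:
  assumes "0 < x" "x < y" "y < pi"
  shows "cot y < cot x"
proof -
  have "0 < sin x" "0 < sin y" "0 < sin (y - x)" using assms by (auto intro!: sin_gt_zero)
  moreover have "cot x - cot y = sin (y - x) / (sin x * sin y)"
    using calculation by (simp add: cot_def sin_diff field_simps)
  ultimately have "0 < cot x - cot y" by simp
  then show ?thesis by simp
qed

text \<open>The chart is minus the cotangent of half the angle counted from \<open>s\<close>, which
  increases over one full turn.\<close>

lemma chart_cis_less_iff:
  assumes "s < t" "t < s + 2 * pi" "s < t'" "t' < s + 2 * pi"
  shows "chart (cis s) (cis t) < chart (cis s) (cis t') \<longleftrightarrow> t < t'"
proof -
  have "cot ((t' - s) / 2) < cot ((t - s) / 2)" if "t < t'"
    using assms that by (intro cot_strict_antimono) auto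
  moreover have "cot ((t - s) / 2) < cot ((t' - s) / 2)" if "t' < t"
    using assms that by (intro cot_strict_antimono) auto
  ultimately show ?thesis
    by (cases t t' rule: linorder_cases) (auto simp: chart_def cayley_cis)
qed

lemma cis_neq:
  assumes "s < t" "t < s + 2 * pi"
  shows "cis s \<noteq> cis t"
proof
  assume "cis s = cis t"
  then have "cis (t - s) = 1" by (simp add: cis_divide [symmetric])
  then have "cos (t - s) = 1" by (simp add: complex_eq_iff)
  then obtain x :: int where x: "t - s = of_int x * 2 * pi" using cos_one_2pi_int by blast
  have "0 < of_int x * (2 * pi)" "of_int x * (2 * pi) < 1 * (2 * pi)"
    using x assms by (simp_all only: mult.assoc [symmetric])
  then have "0 < (of_int x :: real)" "(of_int x :: real) < 1"
    using pi_gt_zero by (simp_all only: zero_less_mult_iff mult_less_cancel_right_pos) auto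
  then show False by simp
qed

text \<open>Cutting the circle at \<open>a\<close> turns cyclic order into linear order in the
  chart. The conditions \<open>a \<noteq> b\<close> and \<open>a \<noteq> c\<close> exclude the
  default value at the cut.\<close>

lemma ccw3_iff:
  "ccw [a, b, c] \<longleftrightarrow> norm a = 1 \<and> norm b = 1 \<and> norm c = 1 \<and> a \<noteq> b \<and> a \<noteq> c \<and>
    chart a b < chart a c"  (is "_ \<longleftrightarrow> ?R")
proof
  assume "ccw [a, b, c]"
  then obtain t0 t1 t2 where t: "a = cis t0" "b = cis t1" "c = cis t2"
    "t0 < t1" "t1 < t2" "t2 < t0 + 2 * pi"
    by (auto simp: ccw_def Cons_eq_map_conv)
  then show ?R using cis_neq[of t0 t1] cis_neq[of t0 t2] chart_cis_less_iff[of t0 t1 t2] by auto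
next
  assume R: ?R
  then obtain s where s: "a = cis s" using circle_cis by blast
  obtain t where t: "s < t" "t < s + 2 * pi" "b = cis t" using circle_cis_above[of b s] R s by metis
  obtain t' where t': "s < t'" "t' < s + 2 * pi" "c = cis t'" using circle_cis_above[of c s] R s by metis
  have "t < t'" using chart_cis_less_iff[OF t(1,2) t'(1,2)] R s t t' by simp
  then show "ccw [a, b, c]"
    unfolding ccw_def using s t t' by (intro exI[of _ "[s, t, t']"]) auto
qed

lemma ccw4_iff:
  "ccw [a, b, c, d] \<longleftrightarrow> norm a = 1 \<and> norm b = 1 \<and> norm c = 1 \<and> norm d = 1 \<and>
    a \<noteq> b \<and> a \<noteq> c \<and> a \<noteq> d \<and> chart a b < chart a c \<and> chart a c < chart a d"
  (is "_ \<longleftrightarrow> ?R")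
proof
  assume "ccw [a, b, c, d]"
  then obtain t0 t1 t2 t3 where t: "a = cis t0" "b = cis t1" "c = cis t2" "d = cis t3"
    "t0 < t1" "t1 < t2" "t2 < t3" "t3 < t0 + 2 * pi"
    by (auto simp: ccw_def Cons_eq_map_conv)
  then show ?R
    using cis_neq[of t0 t1] cis_neq[of t0 t2] cis_neq[of t0 t3]
      chart_cis_less_iff[of t0 t1 t2] chart_cis_less_iff[of t0 t2 t3] by auto
next
  assume R: ?R
  then obtain s where s: "a = cis s" using circle_cis by blast
  obtain t where t: "s < t" "t < s + 2 * pi" "b = cis t" using circle_cis_above[of b s] R s by metis
  obtain t' where t': "s < t'" "t' < s + 2 * pi" "c = cis t'" using circle_cis_above[of c s] R s by metis
  obtain t'' where t'': "s < t''" "t'' < s + 2 * pi" "d = cis t''" using circle_cis_above[of d s] R s by metis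
  have "t < t'" "t' < t''"
    using chart_cis_less_iff[OF t(1,2) t'(1,2)] chart_cis_less_iff[OF t'(1,2) t''(1,2)] R s t t' t''
    by simp_all
  then show "ccw [a, b, c, d]"
    unfolding ccw_def using s t t' t'' by (intro exI[of _ "[s, t, t', t'']"]) auto
qed

text \<open>Adding a full turn to the first two angles moves them behind the other two.\<close>

lemma ccw_rotate2:
  assumes "ccw [a, b, c, d]"
  shows "ccw [c, d, a, b]"
proof -
  obtain t0 t1 t2 t3 where t: "a = cis t0" "b = cis t1" "c = cis t2" "d = cis t3"
    "t0 < t1" "t1 < t2" "t2 < t3" "t3 < t0 + 2 * pi"
    using assms by (auto simp: ccw_def Cons_eq_map_conv)
  have "cis (t0 + 2 * pi) = a" "cis (t1 + 2 * pi) = b"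
    using t by (simp_all add: cis_mult [symmetric])
  then show ?thesis
    unfolding ccw_def using t by (intro exI[of _ "[t2, t3, t0 + 2 * pi, t1 + 2 * pi]"]) auto
qed

section \<open>The Cayley transform and cross ratios\<close>

lemma cayley_plus_i: "z \<noteq> v \<Longrightarrow> (cayley v z + \<i>) * (v - z) = 2 * \<i> * v"
  by (simp add: cayley_def field_simps)

lemma cayley_diff:
  assumes "a \<noteq> z" "a \<noteq> w"
  shows "cayley a z - cayley a w = 2 * \<i> * a * (z - w) / ((a - z) * (a - w))"
  using assms by (simp add: cayley_def divide_simps) (simp add: algebra_simps)

lemma cayley_inj: "a \<noteq> 0 \<Longrightarrow> a \<noteq> z \<Longrightarrow> a \<noteq> w \<Longrightarrow> cayley a z = cayley a w \<Longrightarrow> z = w"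
  using cayley_diff[of a z w] by auto

lemma chart_inj:
  assumes "norm a = 1" "norm z = 1" "norm w = 1" "a \<noteq> z" "a \<noteq> w" "chart a z = chart a w"
  shows "z = w"
  using assms cayley_inj[of a z w] cayley_eq_chart by (metis norm_zero zero_neq_one)

lemma abs_chart_diff:
  assumes "norm a = 1" "norm z = 1" "norm w = 1" "a \<noteq> z" "a \<noteq> w"
  shows "\<bar>chart a z - chart a w\<bar> = 2 * norm (z - w) / (norm (a - z) * norm (a - w))"
proof -
  have "of_real (chart a z - chart a w) = 2 * \<i> * a * (z - w) / ((a - z) * (a - w))"
    using assms cayley_diff[of a z w] by (simp add: cayley_eq_chart)
  then have "norm (of_real (chart a z - chart a w) :: complex) =
      norm (2 * \<i> * a * (z - w) / ((a - z) * (a - w)))"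
    by simp
  then show ?thesis using assms(1) by (simp only: norm_of_real) (simp add: norm_mult norm_divide)
qed

text \<open>Sending \<open>a\<close> to infinity reduces the cross ratio to a ratio of consecutive
  gaps.\<close>

lemma cr_eq_chart:
  assumes "norm a = 1" "norm b = 1" "norm c = 1" "norm d = 1" "a \<noteq> b" "a \<noteq> c" "a \<noteq> d"
  shows "cr a b c d = of_real ((chart a d - chart a c) / (chart a c - chart a b))"
proof -
  have a: "a \<noteq> 0" using assms(1) by auto
  have "of_real ((chart a d - chart a c) / (chart a c - chart a b)) =
    (2 * \<i> * a * (d - c) / ((a - d) * (a - c))) / (2 * \<i> * a * (c - b) / ((a - c) * (a - b)))"
    using assms cayley_diff[of a d c] cayley_diff[of a c b] by (simp add: cayley_eq_chart)
  also have "\<dots> = (d - c) * (a - b) / ((a - d) * (c - b))"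
    using a assms(5-7) by (simp add: divide_simps)
  also have "\<dots> = cr a b c d"
    using assms(5-7) by (simp add: cr_def divide_simps) (simp add: algebra_simps)
  finally show ?thesis by simp
qed

lemma cr_rotate2: "cr c d a b = cr a b c d"
proof -
  have "(a - d) * (b - c) = (c - b) * (d - a)" by (simp add: algebra_simps)
  then show ?thesis by (simp add: cr_def mult.commute)
qed

section \<open>Fans and shears\<close>

text \<open>The angle from \<open>vtx u\<close> to \<open>vtx w\<close> is twice the angle from
  \<open>u\<close> to \<open>w\<close>, so the value is minus the cotangent of the latter.\<close>

lemma chart_vtx:
  assumes "u \<noteq> 0" "w \<noteq> 0"
  shows "chart (vtx u) (vtx w) = - Re (cnj u * w) / Im (cnj u * w)"
proof -
  define c where "c = cnj u * w"
  have n: "vtx u + vtx w = (cnj c + c) / (cnj u * cnj w)"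
    and d: "vtx u - vtx w = (cnj c - c) / (cnj u * cnj w)"
    using assms by (simp_all add: vtx_def c_def field_simps)
  have "cayley (vtx u) (vtx w) = \<i> * (cnj c + c) / (cnj c - c)"
    unfolding cayley_def n d using assms by simp
  also have "cnj c + c = of_real (2 * Re c)" by (simp add: complex_eq_iff)
  also have "cnj c - c = - (\<i> * of_real (2 * Im c))" by (simp add: complex_eq_iff)
  also have "\<i> * of_real (2 * Re c) / - (\<i> * of_real (2 * Im c)) = of_real (- Re c / Im c)"
    by simp
  finally show ?thesis by (simp add: chart_def c_def)
qed

text \<open>As \<open>cnj u * u\<close> is real, subtracting a multiple of \<open>u\<close> shifts
  only the real part of \<open>cnj u * w\<close>; the spacing of the fan is thus
  \<open>(norm u)\<^sup>2\<close>.\<close>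

lemma chart_fan:
  assumes "unimodular u w" "Im (cnj u * w) = 1"
  shows "chart (vtx u) (vtx (w - of_int n * u)) = - Re (cnj u * w) + of_int n * (norm u)\<^sup>2"
proof -
  have "unimodular u (w - of_int n * u)" using unimodular_shear[OF assms(1), of "- n"] by simp
  moreover have "cnj u * (w - of_int n * u) = cnj u * w - of_int n * of_real ((norm u)\<^sup>2)"
    using complex_norm_square[of u] by (simp add: algebra_simps)
  ultimately show ?thesis
    using assms(2) chart_vtx[OF unimodular_nz, of u "w - of_int n * u" u "w - of_int n * u"] by simp
qed

lemma unimodular_fan: "unimodular u w \<Longrightarrow> unimodular u (w - of_int n * u)"
  using unimodular_shear[of u w "- n"] by simp

lemma fan_indexing_vtx:
  assumes "unimodular u w" "{vtx u, vtx w} \<in> farey_edges" "Im (cnj u * w) = 1"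
  shows "fan_indexing (vtx u) (\<lambda>n. {vtx u, vtx (w - of_int n * u)})"
proof -
  let ?z = "\<lambda>n::int. vtx (w - of_int n * u)"
  have u: "u \<noteq> 0" using unimodular_nz(1)[OF assms(1)] .
  have neq: "vtx u \<noteq> ?z n" for n using unimodular_vtx_neq[OF unimodular_fan[OF assms(1)]] .
  have nz: "w - of_int n * u \<noteq> 0" for n using unimodular_nz(2)[OF unimodular_fan[OF assms(1)]] .
  have "inj (\<lambda>n. {vtx u, ?z n})"
  proof (rule injI)
    fix n m assume "{vtx u, ?z n} = {vtx u, ?z m}"
    then have "?z n = ?z m" using neq by (metis doubleton_eq_iff)
    then have "chart (vtx u) (?z n) = chart (vtx u) (?z m)" by (rule arg_cong)
    then show "n = m" using u by (simp add: chart_fan[OF assms(1,3)])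
  qed
  moreover have "cayley (vtx u) (?z n) = of_real (- Re (cnj u * w) + of_int n * (norm u)\<^sup>2)" for n
    using cayley_eq_chart[OF norm_vtx[OF u] norm_vtx[OF nz]] chart_fan[OF assms(1,3)] by simp
  then have "\<exists>w'. w' \<noteq> vtx u \<and> {vtx u, ?z n} = {vtx u, w'} \<and>
      cayley (vtx u) w' = of_real (- Re (cnj u * w) + of_int n * (norm u)\<^sup>2)" for n
    using neq[of n] by (intro exI[of _ "?z n"]) simp
  moreover have "0 < (norm u)\<^sup>2" using u by simp
  ultimately show ?thesis
    unfolding fan_indexing_def bij_betw_def using fan_vtx[OF assms] by blast
qed

text \<open>Both indexings give arithmetic progressions with the same start and the same set of
  values, so each spacing is an integer multiple of the other; positivity makes them equal.\<close>

lemma fan_indexing_unique: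
  assumes "v \<noteq> 0" "fan_indexing v f" "fan_indexing v g" "f 0 = g 0"
  shows "f = g"
proof -
  have "\<exists>x d z. 0 < d \<and> (\<forall>n. z n \<noteq> v \<and> f n = {v, z n} \<and> cayley v (z n) = of_real (x + of_int n * d))"
    if "fan_indexing v f" for f
    using that unfolding fan_indexing_def by metis
  from this[OF assms(2)] this[OF assms(3)] obtain x d z x' d' z' where
    d: "0 < d" "0 < d'" and z: "z n \<noteq> v" "f n = {v, z n}" "cayley v (z n) = of_real (x + of_int n * d)"
    and z': "z' n \<noteq> v" "g n = {v, z' n}" "cayley v (z' n) = of_real (x' + of_int n * d')" for n
    by metis
  have eqD: "z n = z' m" if "f n = g m" for n m
    using that z z' by (metis doubleton_eq_iff)
  have rng: "range f = range g"
    using assms(2,3) by (simp add: fan_indexing_def bij_betw_def)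
  have "of_real x = (of_real x' :: complex)"
    using z(3)[of 0] z'(3)[of 0] eqD[OF assms(4)] by simp
  then have x: "x = x'" by simp
  obtain m where "g 1 = f m" using rng by (metis rangeE rangeI)
  then have "of_real (x' + d') = (of_real (x + of_int m * d) :: complex)"
    using z(3)[of m] z'(3)[of 1] eqD[of m 1] by simp
  then have "x' + d' = x + of_int m * d" by (simp only: of_real_eq_iff)
  then have m: "d' = of_int m * d" using x by simp
  obtain k where "f 1 = g k" using rng by (metis rangeE rangeI)
  then have "of_real (x + d) = (of_real (x' + of_int k * d') :: complex)"
    using z(3)[of 1] z'(3)[of k] eqD[of 1 k] by simp
  then have "x + d = x' + of_int k * d'" by (simp only: of_real_eq_iff)
  then have k: "d = of_int k * d'" using x by simp
  have "0 < of_int m * d" "0 < of_int k * d'" using d m k by linarith+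
  then have "0 < m" "0 < k" using d by (simp_all add: zero_less_mult_iff)
  then have "1 * d \<le> of_int m * d" "1 * d' \<le> of_int k * d'"
    using d by (intro mult_right_mono; simp)+
  then have "d = d'" using m k by linarith
  then have "z n = z' n" for n
    using cayley_inj[OF assms(1)] z z' x by metis
  then show ?thesis using z z' by (intro ext) metis
qed

lemma fan_from_eq: "v \<noteq> 0 \<Longrightarrow> fan_indexing v f \<Longrightarrow> f 0 = e \<Longrightarrow> fan_from v e = f"
  unfolding fan_from_def using fan_indexing_unique by (intro the_equality) auto

section \<open>Farey quads and shear coordinates\<close>

lemma farey_quad_rotate2: "farey_quad e a b c d \<Longrightarrow> farey_quad e c d a b"
  by (auto simp: farey_quad_def insert_commute ccw_rotate2)

text \<open>The third vertices are the fan neighbours of \<open>vtx w\<close> at index -1 and 1,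
  which lie on opposite sides of the edge.\<close>

lemma farey_quad_vtx:
  assumes "unimodular u w" "{vtx u, vtx w} \<in> farey_edges" "Im (cnj u * w) = 1"
  shows "farey_quad {vtx u, vtx w} (vtx u) (vtx (w + u)) (vtx w) (vtx (w - u))"
proof -
  have u: "u \<noteq> 0" "w \<noteq> 0" using unimodular_nz[OF assms(1)] by auto
  have p: "unimodular u (w + u)" "unimodular u (w - u)"
    using unimodular_fan[OF assms(1), of "-1"] unimodular_fan[OF assms(1), of 1] by simp_all
  have c: "chart (vtx u) (vtx (w + u)) = - Re (cnj u * w) - (norm u)\<^sup>2"
    "chart (vtx u) (vtx w) = - Re (cnj u * w)"
    "chart (vtx u) (vtx (w - u)) = - Re (cnj u * w) + (norm u)\<^sup>2"
    using chart_fan[OF assms(1,3), of "-1"] chart_fan[OF assms(1,3), of 0] chart_fan[OF assms(1,3), of 1]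
    by simp_all
  have "ccw [vtx u, vtx (w + u), vtx w, vtx (w - u)]"
    unfolding ccw4_iff c
    using u norm_vtx unimodular_nz(2)[OF p(1)] unimodular_nz(2)[OF p(2)]
      unimodular_vtx_neq[OF assms(1)] unimodular_vtx_neq[OF p(1)] unimodular_vtx_neq[OF p(2)]
    by simp
  then show ?thesis
    using farey_edge_triangles[OF assms(1,2)] by (simp add: farey_quad_def insert_commute)
qed

text \<open>Only two candidates exist for a third vertex, and the cyclic order decides which one is
  \<open>b\<close> and which one is \<open>d\<close>.\<close>

lemma farey_quad_vtx_unique:
  assumes "unimodular u w" "{vtx u, vtx w} \<in> farey_edges" "Im (cnj u * w) = 1"
    and q: "farey_quad {vtx u, vtx w} (vtx u) b (vtx w) d"
  shows "b = vtx (w + u)" "d = vtx (w - u)"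
proof -
  have t: "{vtx u, b, vtx w} \<in> farey_triangles" "{vtx u, vtx w, d} \<in> farey_triangles"
    and less: "chart (vtx u) b < chart (vtx u) (vtx w)" "chart (vtx u) (vtx w) < chart (vtx u) d"
    and neq: "b \<noteq> vtx u" "d \<noteq> vtx u"
    using q by (auto simp: farey_quad_def ccw4_iff)
  have less': "chart (vtx u) (vtx (w + u)) < chart (vtx u) (vtx w)"
    "chart (vtx u) (vtx w) < chart (vtx u) (vtx (w - u))"
    using farey_quad_vtx[OF assms(1-3)] by (auto simp: farey_quad_def ccw4_iff)
  have "b \<in> {vtx u, vtx w, vtx (w + u), vtx (w - u)}"
    using farey_triangle_cases[OF assms(1) t(1)] by blast
  then show "b = vtx (w + u)" using neq less less' by auto
  have "d \<in> {vtx u, vtx w, vtx (w + u), vtx (w - u)}"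
    using farey_triangle_cases[OF assms(1) t(2)] by blast
  then show "d = vtx (w - u)" using neq less less' by auto
qed

locale circle_embedding =
  fixes h :: "complex \<Rightarrow> complex"
  assumes norm_h: "norm z = 1 \<Longrightarrow> norm (h z) = 1"
    and inj_h: "norm z = 1 \<Longrightarrow> norm w = 1 \<Longrightarrow> h z = h w \<Longrightarrow> z = w"
    and ccw_h: "ccw [a, b, c] \<Longrightarrow> ccw [h a, h b, h c]"
begin

lemma chart_h_less:
  assumes "norm a = 1" "norm b = 1" "norm c = 1" "a \<noteq> b" "a \<noteq> c" "chart a b < chart a c"
  shows "chart (h a) (h b) < chart (h a) (h c)"
  using ccw_h[of a b c] assms by (simp add: ccw3_iff)

lemma chart_h_le:
  assumes "norm a = 1" "norm b = 1" "norm c = 1" "a \<noteq> b" "a \<noteq> c" "chart a b \<le> chart a c"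
  shows "chart (h a) (h b) \<le> chart (h a) (h c)"
  using chart_h_less[OF assms(1-5)] chart_inj[OF assms(1-5)] assms(6) by fastforce

text \<open>With \<open>h (vtx u)\<close> at infinity the cross ratio is the ratio of the two gaps
  adjacent to the edge. The other labelling of the quad gives the same value by
  \<open>cr_rotate2\<close>, so the description by \<open>THE\<close> is determined.\<close>

lemma shear_vtx:
  fixes u w
  defines "Y \<equiv> \<lambda>z. chart (h (vtx u)) (h (vtx z))"
  assumes "unimodular u w" "{vtx u, vtx w} \<in> farey_edges" "Im (cnj u * w) = 1"
  shows "shear h {vtx u, vtx w} = ln ((Y (w - u) - Y w) / (Y w - Y (w + u)))"
proof -
  let ?cr = "\<lambda>a b c d. cr (h a) (h b) (h c) (h d)"
  note q = farey_quad_vtx[OF assms(2-4)]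
  have cc: "ccw [vtx u, vtx (w + u), vtx w, vtx (w - u)]" using q by (simp add: farey_quad_def)
  have neq: "h (vtx u) \<noteq> h (vtx z)" if "norm (vtx z) = 1" "vtx u \<noteq> vtx z" for z
    using inj_h[of "vtx u" "vtx z"] that cc by (auto simp: ccw4_iff)
  have cr: "?cr (vtx u) (vtx (w + u)) (vtx w) (vtx (w - u)) =
      of_real ((Y (w - u) - Y w) / (Y w - Y (w + u)))"
    unfolding Y_def by (rule cr_eq_chart) (use cc norm_h neq in \<open>auto simp: ccw4_iff\<close>)
  have uniq: "?cr a b c d = ?cr (vtx u) (vtx (w + u)) (vtx w) (vtx (w - u))"
    if q': "farey_quad {vtx u, vtx w} a b c d" for a b c d
  proof -
    have "a = vtx u \<and> c = vtx w \<or> c = vtx u \<and> a = vtx w"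
      using q' by (auto simp: farey_quad_def doubleton_eq_iff)
    then show ?thesis
    proof
      assume "a = vtx u \<and> c = vtx w"
      then show ?thesis using farey_quad_vtx_unique[OF assms(2-4)] q' by auto
    next
      assume ac: "c = vtx u \<and> a = vtx w"
      then have "d = vtx (w + u)" "b = vtx (w - u)"
        using farey_quad_vtx_unique[OF assms(2-4)] farey_quad_rotate2[OF q'] by auto
      then show ?thesis using ac cr_rotate2 by simp
    qed
  qed
  show ?thesis
    unfolding shear_def
  proof (rule the_equality)
    show "\<exists>a b c d. farey_quad {vtx u, vtx w} a b c d \<and>
        ln ((Y (w - u) - Y w) / (Y w - Y (w + u))) = ln (Re (?cr a b c d))"
      using q cr by (metis Re_complex_of_real)
  next
    fix x assume "\<exists>a b c d. farey_quad {vtx u, vtx w} a b c d \<and> x = ln (Re (?cr a b c d))"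
    then show "x = ln ((Y (w - u) - Y w) / (Y w - Y (w + u)))"
      using uniq cr by (metis Re_complex_of_real)
  qed
qed

end

section \<open>Differentiability at the vertices\<close>

text \<open>The bound \<open>m - 1 \<le> n\<close> admits the empty sum, which occurs among the
  partial sums over a fan.\<close>

lemma sum_telescope_int:
  fixes g :: "int \<Rightarrow> 'a :: ab_group_add"
  assumes "m - 1 \<le> n"
  shows "(\<Sum>k\<in>{m..n}. g k - g (k - 1)) = g n - g (m - 1)"
  using assms
proof (induction n rule: int_ge_induct)
  case base
  then show ?case by simp
next
  case (step i)
  then have "{m..i + 1} = insert (i + 1) {m..i}" by auto
  then show ?case using step by simp
qed

text \<open>Far out at either end the increments of \<open>y n - D * of_int n\<close> are at most
  \<open>e\<close> in absolute value, so this deviation grows with slope at most \<open>e\<close>;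
  the finitely many remaining indices go into \<open>C\<close>.\<close>

lemma increments_tendsto_imp_almost_linear:
  fixes y :: "int \<Rightarrow> real"
  assumes up: "(\<lambda>n. y (int n + 1) - y (int n)) \<longlonglongrightarrow> D"
    and down: "(\<lambda>n. y (- int n) - y (- int n - 1)) \<longlonglongrightarrow> D"
    and e: "0 < e"
  obtains C where "\<And>n. \<bar>y n - D * of_int n\<bar> \<le> C + e * \<bar>of_int n\<bar>"
proof -
  define G where "G n = y n - D * of_int n" for n
  obtain N1 where N1: "\<bar>y (int n + 1) - y (int n) - D\<bar> < e" if "n \<ge> N1" for n
    using LIMSEQ_D[OF up e] by (auto simp: real_norm_def)
  obtain N2 where N2: "\<bar>y (- int n) - y (- int n - 1) - D\<bar> < e" if "n \<ge> N2" for n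
    using LIMSEQ_D[OF down e] by (auto simp: real_norm_def)
  define N where "N = int (max N1 N2)"
  have N: "0 \<le> N" by (simp add: N_def)
  have G1: "\<bar>G (n + 1) - G n\<bar> \<le> e" if "N \<le> n" for n
  proof -
    have "N1 \<le> nat n" using that unfolding N_def by linarith
    then show ?thesis using N1[of "nat n"] that N by (simp add: G_def algebra_simps)
  qed
  have G2: "\<bar>G (n - 1) - G n\<bar> \<le> e" if "n \<le> - N" for n
  proof -
    have "N2 \<le> nat (- n)" using that unfolding N_def by linarith
    then show ?thesis using N2[of "nat (- n)"] that N by (simp add: G_def algebra_simps)
  qed
  have up': "\<bar>G n\<bar> \<le> \<bar>G N\<bar> + e * (of_int n - of_int N)" if "N \<le> n" for n
    using that
  proof (induction n rule: int_ge_induct)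
    case (step i)
    then show ?case using G1[of i] by (simp add: algebra_simps)
  qed simp
  have down': "\<bar>G n\<bar> \<le> \<bar>G (- N)\<bar> + e * (- of_int N - of_int n)" if "n \<le> - N" for n
    using that
  proof (induction n rule: int_le_induct)
    case (step i)
    then show ?case using G2[of i] by (simp add: algebra_simps)
  qed simp
  \<comment> \<open>Bounds the middle block, including the starting values \<open>G N\<close> and
    \<open>G (- N)\<close> of the two tails.\<close>
  define C where "C = (\<Sum>k\<in>{-N..N}. \<bar>G k\<bar>)"
  have C: "\<bar>G k\<bar> \<le> C" if "k \<in> {-N..N}" for k
    unfolding C_def by (rule member_le_sum[OF that]) auto
  have "\<bar>G n\<bar> \<le> C + e * \<bar>of_int n\<bar>" for n
  proof -
    consider "N \<le> n" | "n \<le> - N" | "n \<in> {-N..N}" by fastforce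
    then show ?thesis
    proof cases
      case 1
      have "e * (of_int n - of_int N) \<le> e * \<bar>of_int n\<bar>"
        using e N by (intro mult_left_mono) auto
      then show ?thesis using up'[OF 1] C[of N] N by simp
    next
      case 2
      have "e * (- of_int N - of_int n) \<le> e * \<bar>of_int n\<bar>"
        using e N by (intro mult_left_mono) auto
      then show ?thesis using down'[OF 2] C[of "- N"] N by simp
    next
      case 3
      have "0 \<le> e * \<bar>of_int n\<bar>" using e by simp
      then show ?thesis using C[OF 3] by simp
    qed
  qed
  then show ?thesis using that[of C] by (simp add: G_def)
qed

text \<open>A connected set with more than one point has no isolated points. This makes limits along
  the circle unique.\<close>

lemma unit_circle_at_within_nontrivial:
  assumes "norm (v::complex) = 1"
  shows "at v within sphere 0 1 \<noteq> bot"
proof -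
  have "connected (sphere (0::complex) 1)" by (rule connected_sphere) simp
  moreover have "v \<in> sphere 0 1" "- v \<in> sphere 0 1" "v \<noteq> - v"
    using assms by auto
  ultimately have "v islimpt sphere 0 1"
    using connected_imp_perfect[of "sphere 0 1" v] by (metis singletonD)
  then show ?thesis by (simp add: trivial_limit_within)
qed

lemma circle_deriv_eq:
  assumes "norm v = 1" "(h has_field_derivative D) (at v within sphere 0 1)"
  shows "circle_deriv h v = D"
  using assms unit_circle_at_within_nontrivial tendsto_Lim
  unfolding circle_deriv_def has_field_derivative_iff by blast

context circle_embedding
begin

text \<open>By monotonicity the image of \<open>z\<close> lies between the images of the two fan
  edges enclosing \<open>z\<close>, where \<open>y\<close> is already known to be almost
  linear.\<close>

lemma chart_almost_linear:
  fixes u w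
  defines "y \<equiv> \<lambda>n::int. chart (h (vtx u)) (h (vtx (w - of_int n * u)))"
  assumes uw: "unimodular u w" "Im (cnj u * w) = 1"
    and D: "0 < D" and lim: "(\<lambda>n. y (int n + 1) - y (int n)) \<longlonglongrightarrow> D"
      "(\<lambda>n. y (- int n) - y (- int n - 1)) \<longlonglongrightarrow> D"
    and e: "0 < e"
  obtains C where "\<And>z. norm z = 1 \<Longrightarrow> z \<noteq> vtx u \<Longrightarrow>
    \<bar>chart (h (vtx u)) (h z) - D / (norm u)\<^sup>2 * chart (vtx u) z\<bar> \<le> C + e * \<bar>chart (vtx u) z\<bar>"
proof -
  define \<delta> where "\<delta> = (norm u)\<^sup>2"
  define x0 where "x0 = - Re (cnj u * w)"
  define c where "c = D / \<delta>"
  have u: "u \<noteq> 0" using unimodular_nz(1)[OF uw(1)] .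
  have \<delta>: "0 < \<delta>" using u by (simp add: \<delta>_def)
  have c: "0 < c" "c * \<delta> = D" using D \<delta> by (simp_all add: c_def)
  have v1: "norm (vtx u) = 1" using norm_vtx[OF u] .
  \<comment> \<open>The factor \<open>\<delta>\<close> converts an error per fan index into an error
    per unit of the chart.\<close>
  obtain C where C: "\<bar>y n - D * of_int n\<bar> \<le> C + e * \<delta> * \<bar>of_int n\<bar>" for n
    using increments_tendsto_imp_almost_linear[OF lim, of "e * \<delta>"] e \<delta> by auto
  \<comment> \<open>The enlarged constant absorbs the offset \<open>x0\<close>, one gap
    \<open>D\<close>, and the passage from \<open>\<delta>\<close> times the index to the chart
    value.\<close>
  have "\<bar>chart (h (vtx u)) (h z) - c * chart (vtx u) z\<bar> \<le>
      (C + c * \<bar>x0\<bar> + D + e * (\<bar>x0\<bar> + \<delta>)) + e * \<bar>chart (vtx u) z\<bar>"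
    if z: "norm z = 1" "z \<noteq> vtx u" for z
  proof -
    define X where "X = chart (vtx u) z"
    define Y where "Y = chart (h (vtx u)) (h z)"
    \<comment> \<open>The enclosing fan edges have the indices \<open>n\<close> and
      \<open>n + 1\<close>.\<close>
    define n where "n = \<lfloor>(X - x0) / \<delta>\<rfloor>"
    have "of_int n \<le> (X - x0) / \<delta>" "(X - x0) / \<delta> \<le> of_int n + 1"
      unfolding n_def by linarith+
    then have n: "x0 + of_int n * \<delta> \<le> X" "X \<le> x0 + of_int (n + 1) * \<delta>"
      using \<delta> by (simp_all add: field_simps)
    have pt: "norm (vtx (w - of_int k * u)) = 1" "vtx u \<noteq> vtx (w - of_int k * u)" for k
      using norm_vtx unimodular_nz(2)[OF unimodular_fan[OF uw(1)]]
        unimodular_vtx_neq[OF unimodular_fan[OF uw(1)]] by auto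
    have "chart (vtx u) (vtx (w - of_int n * u)) \<le> chart (vtx u) z"
      using n(1) unfolding chart_fan[OF uw] by (simp add: x0_def \<delta>_def X_def)
    then have y1: "y n \<le> Y"
      unfolding y_def Y_def using chart_h_le[OF v1 pt(1) z(1) pt(2)] z(2) by simp
    have "chart (vtx u) z \<le> chart (vtx u) (vtx (w - of_int (n + 1) * u))"
      using n(2) unfolding chart_fan[OF uw] by (simp add: x0_def \<delta>_def X_def)
    then have y2: "Y \<le> y (n + 1)"
      unfolding y_def Y_def using chart_h_le[OF v1 z(1) pt(1) _ pt(2), of "n + 1"] z(2) by simp
    have abs_n: "\<delta> * \<bar>of_int n\<bar> \<le> \<bar>X\<bar> + \<bar>x0\<bar> + \<delta>" "\<delta> * \<bar>of_int (n + 1)\<bar> \<le> \<bar>X\<bar> + \<bar>x0\<bar> + \<delta>"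
      using n \<delta> by (auto simp: abs_if algebra_simps)
    have en: "e * \<delta> * \<bar>of_int n\<bar> \<le> e * (\<bar>X\<bar> + \<bar>x0\<bar> + \<delta>)"
      "e * \<delta> * \<bar>of_int (n + 1)\<bar> \<le> e * (\<bar>X\<bar> + \<bar>x0\<bar> + \<delta>)"
      using mult_left_mono[OF abs_n(1), of e] mult_left_mono[OF abs_n(2), of e] e
      by (simp_all add: mult.assoc)
    have cX: "c * x0 + D * of_int n \<le> c * X" "c * X \<le> c * x0 + D * of_int n + D"
      using mult_left_mono[OF n(1), of c] mult_left_mono[OF n(2), of c] c(1)
      unfolding c(2) [symmetric] by (simp_all add: algebra_simps)
    have x0: "\<bar>c * x0\<bar> \<le> c * \<bar>x0\<bar>" using c by (simp add: abs_mult)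
    have "\<bar>Y - c * X\<bar> \<le> C + c * \<bar>x0\<bar> + D + e * (\<bar>X\<bar> + \<bar>x0\<bar> + \<delta>)"
      using y1 y2 C[of n] C[of "n + 1"] en cX x0 D by (simp add: algebra_simps abs_le_iff)
    then show ?thesis by (simp add: X_def Y_def algebra_simps)
  qed
  then show ?thesis unfolding c_def \<delta>_def by (rule that)
qed

text \<open>By \<open>cayley_plus_i\<close>, \<open>v - z\<close> and \<open>h v - h z\<close> are,
  up to constant factors, the reciprocals of the charts shifted by \<open>\<i>\<close>. The
  difference quotient is therefore a constant over \<open>q\<close>, and \<open>q\<close> tends to
  the slope \<open>c\<close> as the chart of \<open>z\<close> goes to infinity.\<close>

lemma deriv_at_vertex:
  fixes u w
  defines "y \<equiv> \<lambda>n::int. chart (h (vtx u)) (h (vtx (w - of_int n * u)))"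
  assumes uw: "unimodular u w" "Im (cnj u * w) = 1"
    and D: "0 < D" and lim: "(\<lambda>n. y (int n + 1) - y (int n)) \<longlonglongrightarrow> D"
      "(\<lambda>n. y (- int n) - y (- int n - 1)) \<longlonglongrightarrow> D"
  shows "(h has_field_derivative h (vtx u) / vtx u * of_real ((norm u)\<^sup>2 / D))
    (at (vtx u) within sphere 0 1)"
proof -
  define v where "v = vtx u"
  define c where "c = D / (norm u)\<^sup>2"
  define X where "X = chart v"
  define Y where "Y z = chart (h v) (h z)" for z
  define q where "q z = (of_real (Y z) + \<i>) / (of_real (X z) + \<i> :: complex)" for z
  have u: "u \<noteq> 0" using unimodular_nz(1)[OF uw(1)] .
  have c: "0 < c" using D u by (simp add: c_def)
  have v1: "norm v = 1" using norm_vtx[OF u] by (simp add: v_def)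
  have v0: "v \<noteq> 0" "h v \<noteq> 0" using v1 norm_h[OF v1] by auto
  have hz: "h v \<noteq> h z" if "norm z = 1" "z \<noteq> v" for z using inj_h[of v z] that v1 by auto
  have Xi: "(of_real (X z) + \<i>) * (v - z) = 2 * \<i> * v"
    and Yi: "(of_real (Y z) + \<i>) * (h v - h z) = 2 * \<i> * h v" if "norm z = 1" "z \<noteq> v" for z
    using cayley_plus_i[of z v] cayley_plus_i[of "h z" "h v"] that v1 norm_h hz[OF that]
    by (auto simp: X_def Y_def cayley_eq_chart)
  have slope: "(h z - h v) / (z - v) = h v / v / q z" if z: "norm z = 1" "z \<noteq> v" for z
  proof -
    have 1: "of_real (X z) + \<i> = 2 * \<i> * v / (v - z)" using Xi[OF z] z by (simp add: field_simps)
    have 2: "of_real (Y z) + \<i> = 2 * \<i> * h v / (h v - h z)"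
      using Yi[OF z] hz[OF z] by (simp add: field_simps)
    show ?thesis unfolding q_def 1 2 using v0 z hz[OF z] by (simp add: divide_simps) (simp add: algebra_simps)
  qed
  have "(q \<longlongrightarrow> of_real c) (at v within sphere 0 1)"
    unfolding tendsto_iff eventually_at
  proof (intro allI impI)
    fix e :: real assume e: "0 < e"
    obtain C where C: "\<bar>Y z - c * X z\<bar> \<le> C + e / 2 * \<bar>X z\<bar>" if "norm z = 1" "z \<noteq> v" for z
      using chart_almost_linear[OF uw D lim[unfolded y_def], of "e / 2"] e
      unfolding v_def c_def X_def Y_def by auto
    \<comment> \<open>Bounds the part of the error that does not grow with \<open>X z\<close>; the
      outer absolute value makes it nonnegative.\<close>
    define K where "K = \<bar>C + \<bar>1 - c\<bar>\<bar>"
    have K: "0 \<le> K" "C + \<bar>1 - c\<bar> \<le> K" by (simp_all add: K_def)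
    show "\<exists>d>0. \<forall>z\<in>sphere 0 1. z \<noteq> v \<and> dist z v < d \<longrightarrow> dist (q z) (of_real c) < e"
    \<comment> \<open>The norm of \<open>of_real (X z) + \<i>\<close> is
      \<open>2 / norm (v - z)\<close>, so within this radius \<open>K\<close> is less than
      \<open>e / 2\<close> times that norm. The \<open>+ 1\<close> covers
      \<open>K = 0\<close>.\<close>
    proof (intro exI[of _ "e / (K + 1)"] conjI ballI impI)
      show "0 < e / (K + 1)" using e K by simp
    next
      fix z assume "z \<in> sphere 0 1" "z \<noteq> v \<and> dist z v < e / (K + 1)"
      then have z: "norm z = 1" "z \<noteq> v" and zd: "norm (v - z) * (K + 1) < e"
        using K by (auto simp: dist_norm norm_minus_commute field_simps)
      let ?x = "of_real (X z) + \<i> :: complex"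
      have nx: "norm ?x * norm (v - z) = 2"
        using arg_cong[OF Xi[OF z], of norm] v1 by (simp add: norm_mult)
      have x0: "?x \<noteq> 0" using nx by auto
      have Xx: "\<bar>X z\<bar> \<le> norm ?x" using abs_Re_le_cmod[of ?x] by simp
      have "q z - of_real c = (of_real (Y z - c * X z) + \<i> * of_real (1 - c)) / ?x"
        using x0 by (simp add: q_def field_simps)
      then have "norm (q z - of_real c) * norm ?x = norm (of_real (Y z - c * X z) + \<i> * of_real (1 - c))"
        using x0 by (simp add: norm_divide)
      also have "\<dots> \<le> \<bar>Y z - c * X z\<bar> + \<bar>1 - c\<bar>"
        by (rule order_trans[OF norm_triangle_ineq]) (simp add: norm_mult del: of_real_diff)
      also have "\<dots> \<le> K + e / 2 * norm ?x"
        using C[OF z] K(2) mult_left_mono[OF Xx, of "e / 2"] e by linarith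
      also have "\<dots> < e * norm ?x"
      proof -
        have "2 * K = K * norm (v - z) * norm ?x" using nx by (simp add: mult.assoc mult.commute[of "norm ?x"])
        also have "K * norm (v - z) < e"
          using zd z by (simp add: algebra_simps) (smt (verit) zero_less_norm_iff right_minus_eq)
        then have "K * norm (v - z) * norm ?x < e * norm ?x" using x0 by simp
        finally show ?thesis by simp
      qed
      finally show "dist (q z) (of_real c) < e" using x0 by (simp add: dist_norm)
    qed
  qed
  then have "((\<lambda>z. h v / v / q z) \<longlongrightarrow> h v / v / of_real c) (at v within sphere 0 1)"
    using c by (intro tendsto_intros) auto
  moreover have "\<forall>\<^sub>F z in at v within sphere 0 1. h v / v / q z = (h z - h v) / (z - v)"
    unfolding eventually_at_filter using slope by (intro always_eventually) auto
  ultimately have "((\<lambda>z. (h z - h v) / (z - v)) \<longlongrightarrow> h v / v / of_real c) (at v within sphere 0 1)"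
    by (rule Lim_transform_eventually)
  then show ?thesis
    unfolding has_field_derivative_iff by (simp add: v_def c_def)
qed

end

section \<open>The diamond shear formula\<close>

lemma farey_edge_vertex: "{a, b} \<in> farey_edges \<Longrightarrow> a \<in> farey_vertices"
  unfolding farey_edges_def farey_vertices_def by (auto simp: doubleton_eq_iff)

text \<open>On the unit circle \<open>cnj\<close> is inversion. In the final formula the unit
  factors \<open>a * b\<close> and \<open>h a * h b\<close> cancel against those of the
  derivatives.\<close>

lemma diff_squared_unit_circle:
  fixes a b :: complex
  assumes "norm a = 1" "norm b = 1"
  shows "(a - b)\<^sup>2 = - (a * b * of_real ((norm (a - b))\<^sup>2))"
proof -
  have "a * cnj a = 1" "b * cnj b = 1"
    using assms by (simp_all flip: complex_norm_square)
  then have "a * b * ((a - b) * cnj (a - b)) = - (a - b)\<^sup>2"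
    by (simp add: power2_eq_square) algebra
  then show ?thesis by (simp add: complex_norm_square del: of_real_power)
qed

text \<open>The side lengths of the quadrilateral cancel, only its diagonal \<open>(a, b)\<close> survives.\<close>

lemma chart_diff_product:
  assumes "norm a = 1" "norm b = 1" "norm p = 1" "norm q = 1"
    and "a \<noteq> b" "a \<noteq> p" "a \<noteq> q" "b \<noteq> p" "b \<noteq> q"
  shows "\<bar>chart a q - chart a b\<bar> * \<bar>chart a b - chart a p\<bar> *
    (\<bar>chart b p - chart b a\<bar> * \<bar>chart b a - chart b q\<bar>) = 16 / norm (a - b) ^ 4"
proof -
  have 1: "\<bar>chart a q - chart a b\<bar> = 2 * norm (b - q) / (norm (a - q) * norm (a - b))"
    "\<bar>chart a b - chart a p\<bar> = 2 * norm (b - p) / (norm (a - b) * norm (a - p))"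
    "\<bar>chart b p - chart b a\<bar> = 2 * norm (a - p) / (norm (b - p) * norm (a - b))"
    "\<bar>chart b a - chart b q\<bar> = 2 * norm (a - q) / (norm (a - b) * norm (b - q))"
    using assms by (simp_all add: abs_chart_diff norm_minus_commute)
  have "norm (a - b) \<noteq> 0" "norm (a - p) \<noteq> 0" "norm (a - q) \<noteq> 0" "norm (b - p) \<noteq> 0" "norm (b - q) \<noteq> 0"
    using assms by simp_all
  then show ?thesis unfolding 1 by (simp add: divide_simps) (simp add: algebra_simps power4_eq_xxxx)
qed

context circle_embedding
begin

lemma chart_h_fan_increasing:
  fixes u w
  defines "y \<equiv> \<lambda>n::int. chart (h (vtx u)) (h (vtx (w - of_int n * u)))"
  assumes uw: "unimodular u w" "Im (cnj u * w) = 1"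
  shows "y n < y (n + 1)"
proof -
  have pt: "norm (vtx (w - of_int k * u)) = 1" "vtx u \<noteq> vtx (w - of_int k * u)" for k
    using norm_vtx unimodular_nz(2)[OF unimodular_fan[OF uw(1)]]
      unimodular_vtx_neq[OF unimodular_fan[OF uw(1)]] by auto
  have "chart (vtx u) (vtx (w - of_int n * u)) < chart (vtx u) (vtx (w - of_int (n + 1) * u))"
    unfolding chart_fan[OF uw] using unimodular_nz(1)[OF uw(1)] by (simp add: algebra_simps)
  then show ?thesis
    unfolding y_def
    by (intro chart_h_less pt norm_vtx unimodular_nz(1)[OF uw(1)])
qed

text \<open>Shears are differences of the logarithmic gaps \<open>g\<close>, so all sums telescope.
  The vanishing total gives \<open>g\<close> the same limit at both ends, and \<open>D\<close> is
  its exponential.\<close>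

lemma fan_limit:
  fixes u w
  defines "y \<equiv> \<lambda>n::int. chart (h (vtx u)) (h (vtx (w - of_int n * u)))"
  assumes uw: "unimodular u w" "{vtx u, vtx w} \<in> farey_edges" "Im (cnj u * w) = 1"
    and P0: "shear h \<in> shear_P0"
  obtains D where "0 < D" "(\<lambda>n. y (int n + 1) - y (int n)) \<longlonglongrightarrow> D"
    "(\<lambda>n. y (- int n) - y (- int n - 1)) \<longlonglongrightarrow> D"
    "p_minus (shear h) (vtx u) {vtx u, vtx w} - p_plus (shear h) (vtx u) {vtx u, vtx w} =
      ln (y 1 - y 0) + ln (y 0 - y (- 1)) - 2 * ln D"
proof -
  define f where "f n = {vtx u, vtx (w - of_int n * u)}" for n :: int
  define g where "g n = ln (y (n + 1) - y n)" for n
  have pos: "0 < y (n + 1) - y n" for n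
    using chart_h_fan_increasing[OF uw(1,3), of n] by (simp add: y_def)
  have s: "shear h (f k) = g k - g (k - 1)" for k
  proof -
    define w' where "w' = w - of_int k * u"
    have e: "{vtx u, vtx w'} \<in> farey_edges"
      using farey_edge_shift[OF uw(1,2), of "- k"] by (simp add: w'_def)
    have i: "Im (cnj u * w') = 1" using uw(3) by (simp add: w'_def algebra_simps)
    have "shear h (f k) = ln ((y (k + 1) - y k) / (y k - y (k - 1)))"
      using shear_vtx[OF unimodular_fan[OF uw(1), of k], folded w'_def, OF e i]
      by (simp add: f_def y_def w'_def algebra_simps)
    then show ?thesis using pos[of k] pos[of "k - 1"] by (simp add: g_def ln_div)
  qed
  have fi: "fan_indexing (vtx u) f" using fan_indexing_vtx[OF uw] by (simp add: f_def [abs_def])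
  have from_eq: "fan_from (vtx u) {vtx u, vtx w} = f"
    using fan_from_eq[OF _ fi] norm_vtx[OF unimodular_nz(1)[OF uw(1)]] by (force simp: f_def)
  have sum_up: "(\<Sum>k\<in>{0..int n}. shear h (f k)) = g (int n) - g (- 1)" for n
    unfolding s using sum_telescope_int[of 0 "int n" g] by simp
  have sum_down: "(\<Sum>k\<in>{- int n..- 1}. shear h (f k)) = g (- 1) - g (- int n - 1)" for n
    unfolding s using sum_telescope_int[of "- int n" "- 1" g] by simp
  \<comment> \<open>\<open>p_plus\<close> leaves out the edge of index 0, so the boundary term is
    \<open>g 0\<close> here and not \<open>g (- 1)\<close>.\<close>
  have sum_plus: "(\<Sum>k\<in>{1..int n}. shear h (f k)) = g (int n) - g 0" for n
    unfolding s using sum_telescope_int[of 1 "int n" g] by simp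
  have v: "vtx u \<in> farey_vertices" using farey_edge_vertex[OF uw(2)] .
  have conv: "convergent (\<lambda>n. g (int n) - g (- 1))" "convergent (\<lambda>n. g (- 1) - g (- int n - 1))"
    and lim0: "lim (\<lambda>n. g (- 1) - g (- int n - 1)) + lim (\<lambda>n. g (int n) - g (- 1)) = 0"
    using P0 v fi unfolding shear_P0_def shear_P_def sum_up [symmetric] sum_down [symmetric] by blast+
  obtain L where L: "(\<lambda>n. g (int n) - g (- 1)) \<longlonglongrightarrow> L" using conv(1) by (auto simp: convergent_def)
  obtain M where M: "(\<lambda>n. g (- 1) - g (- int n - 1)) \<longlonglongrightarrow> M" using conv(2) by (auto simp: convergent_def)
  define l where "l = L + g (- 1)"
  \<comment> \<open>\<open>L\<close> is the upper limit of \<open>g\<close> minus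
    \<open>g (- 1)\<close>, and \<open>M\<close> is \<open>g (- 1)\<close> minus the lower limit, so
    their vanishing sum identifies the two limits.\<close>
  have M_eq: "M = - L" using lim0 limI[OF L] limI[OF M] by simp
  have up: "(\<lambda>n. g (int n)) \<longlonglongrightarrow> l"
    using tendsto_add[OF L tendsto_const[of "g (- 1)"]] by (simp add: l_def)
  have down: "(\<lambda>n. g (- int n - 1)) \<longlonglongrightarrow> l"
    using tendsto_diff[OF tendsto_const[of "g (- 1)"] M] by (simp add: l_def M_eq add.commute)
  have exp_g: "exp (g n) = y (n + 1) - y n" for n using pos[of n] by (simp add: g_def)
  show ?thesis
  proof (rule that[of "exp l"])
    show "(\<lambda>n. y (int n + 1) - y (int n)) \<longlonglongrightarrow> exp l"
      using tendsto_exp[OF up] by (simp add: exp_g)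
    show "(\<lambda>n. y (- int n) - y (- int n - 1)) \<longlonglongrightarrow> exp l"
      using tendsto_exp[OF down] by (simp add: exp_g)
    have "p_plus (shear h) (vtx u) {vtx u, vtx w} = l - g 0"
      unfolding p_plus_def from_eq sum_plus by (intro limI tendsto_intros up)
    moreover have "p_minus (shear h) (vtx u) {vtx u, vtx w} = g (- 1) - l"
      unfolding p_minus_def from_eq sum_down by (intro limI tendsto_intros down)
    ultimately show "p_minus (shear h) (vtx u) {vtx u, vtx w} - p_plus (shear h) (vtx u) {vtx u, vtx w} =
      ln (y 1 - y 0) + ln (y 0 - y (- 1)) - 2 * ln (exp l)"
      by (simp add: g_def)
  qed simp
qed

text \<open>\<open>fan_limit\<close> applies at both ends, and \<open>chart_diff_product\<close>
  evaluates the four adjacent gaps. The scale factors \<open>(norm u)\<^sup>2\<close> and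
  \<open>(norm w)\<^sup>2\<close> of the derivatives are tied to \<open>norm (a - b)\<close> because
  the determinant is 1.\<close>

lemma diamond_shear_edge:
  assumes P0: "shear h \<in> shear_P0" and e: "{a, b} \<in> farey_edges"
  obtains \<alpha> \<beta> :: real where "0 < \<alpha>" "0 < \<beta>"
    "(h has_field_derivative h a / a * of_real \<alpha>) (at a within sphere 0 1)"
    "(h has_field_derivative h b / b * of_real \<beta>) (at b within sphere 0 1)"
    "diamond_shear h {a, b} = 1 / 2 * ln (\<alpha> * \<beta> * (norm (a - b))\<^sup>2 / (norm (h a - h b))\<^sup>2)"
proof -
  obtain u w where uw: "unimodular u w" "Im (cnj u * w) = 1" and ab: "a = vtx u" "b = vtx w"
    using farey_edge_form[OF e] by blast
  \<comment> \<open>Exchanging the ends costs a sign, which keeps the determinant equal to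
    1.\<close>
  have wu: "unimodular w (- u)" "Im (cnj w * (- u)) = 1"
    using unimodular_minus2[OF unimodular_sym[OF uw(1)]] uw(2) by (simp_all add: algebra_simps)
  have e1: "{vtx u, vtx w} \<in> farey_edges" and e2: "{vtx w, vtx (- u)} \<in> farey_edges"
    using e ab by (simp_all add: insert_commute)
  have nz: "u \<noteq> 0" "w \<noteq> 0" using unimodular_nz[OF uw(1)] by auto
  define p q where "p = vtx (w + u)" and "q = vtx (w - u)"
  \<comment> \<open>Seen from \<open>b\<close>, \<open>p\<close> has index 1 and \<open>q\<close>
    has index -1, the reverse of the order seen from \<open>a\<close>.\<close>
  have pq: "vtx (- u - w) = p" "vtx (- u + w) = q"
    using vtx_minus[of "w + u"] by (simp_all add: p_def q_def algebra_simps)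
  have quad: "ccw [a, p, b, q]" "ccw [b, q, a, p]"
    using farey_quad_vtx[OF uw(1) e1 uw(2)] ccw_rotate2
    by (auto simp: farey_quad_def ab p_def q_def)
  have unit: "norm a = 1" "norm b = 1" "norm p = 1" "norm q = 1"
    and neq: "a \<noteq> b" "a \<noteq> p" "a \<noteq> q" "b \<noteq> p" "b \<noteq> q"
    using quad by (auto simp: ccw4_iff)
  let ?Y = "\<lambda>x z. chart (h x) (h z)"
  define s t where "s = norm (a - b)" and "t = norm (h a - h b)"
  have t: "0 < t" using inj_h[OF unit(1,2)] neq(1) by (auto simp: t_def)
  obtain D where D: "0 < D"
    and Dd: "(h has_field_derivative h a / a * of_real ((norm u)\<^sup>2 / D)) (at a within sphere 0 1)"
    and Dp: "p_minus (shear h) a {a, b} - p_plus (shear h) a {a, b} =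
      ln (?Y a q - ?Y a b) + ln (?Y a b - ?Y a p) - 2 * ln D"
  proof (rule fan_limit[OF uw(1) e1 uw(2) P0])
    fix D assume "0 < D"
      "(\<lambda>n. ?Y (vtx u) (vtx (w - of_int (int n + 1) * u)) - ?Y (vtx u) (vtx (w - of_int (int n) * u))) \<longlonglongrightarrow> D"
      "(\<lambda>n. ?Y (vtx u) (vtx (w - of_int (- int n) * u)) - ?Y (vtx u) (vtx (w - of_int (- int n - 1) * u))) \<longlonglongrightarrow> D"
      "p_minus (shear h) (vtx u) {vtx u, vtx w} - p_plus (shear h) (vtx u) {vtx u, vtx w} =
        ln (?Y (vtx u) (vtx (w - of_int 1 * u)) - ?Y (vtx u) (vtx (w - of_int 0 * u))) +
        ln (?Y (vtx u) (vtx (w - of_int 0 * u)) - ?Y (vtx u) (vtx (w - of_int (- 1) * u))) - 2 * ln D"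
    then show thesis
      using that[of D] deriv_at_vertex[OF uw] by (simp add: ab p_def q_def)
  qed
  obtain F where F: "0 < F"
    and Fd: "(h has_field_derivative h b / b * of_real ((norm w)\<^sup>2 / F)) (at b within sphere 0 1)"
    and Fp: "p_minus (shear h) b {a, b} - p_plus (shear h) b {a, b} =
      ln (?Y b p - ?Y b a) + ln (?Y b a - ?Y b q) - 2 * ln F"
  proof (rule fan_limit[OF wu(1) e2 wu(2) P0])
    fix F assume "0 < F"
      "(\<lambda>n. ?Y (vtx w) (vtx (- u - of_int (int n + 1) * w)) - ?Y (vtx w) (vtx (- u - of_int (int n) * w))) \<longlonglongrightarrow> F"
      "(\<lambda>n. ?Y (vtx w) (vtx (- u - of_int (- int n) * w)) - ?Y (vtx w) (vtx (- u - of_int (- int n - 1) * w))) \<longlonglongrightarrow> F"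
      "p_minus (shear h) (vtx w) {vtx w, vtx (- u)} - p_plus (shear h) (vtx w) {vtx w, vtx (- u)} =
        ln (?Y (vtx w) (vtx (- u - of_int 1 * w)) - ?Y (vtx w) (vtx (- u - of_int 0 * w))) +
        ln (?Y (vtx w) (vtx (- u - of_int 0 * w)) - ?Y (vtx w) (vtx (- u - of_int (- 1) * w))) - 2 * ln F"
    then show thesis
      using that[of F] deriv_at_vertex[OF wu] pq by (simp add: ab insert_commute)
  qed
  have pos: "0 < ?Y a q - ?Y a b" "0 < ?Y a b - ?Y a p" "0 < ?Y b p - ?Y b a" "0 < ?Y b a - ?Y b q"
    using quad unit neq by (auto intro!: chart_h_less simp: ccw4_iff)
  have hneq: "h a \<noteq> h b" "h a \<noteq> h p" "h a \<noteq> h q" "h b \<noteq> h p" "h b \<noteq> h q"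
    using inj_h unit neq by blast+
  have prod: "(?Y a q - ?Y a b) * (?Y a b - ?Y a p) * ((?Y b p - ?Y b a) * (?Y b a - ?Y b q)) = 16 / t ^ 4"
    using chart_diff_product[OF unit[THEN norm_h] hneq] pos by (simp add: t_def)
  have "4 * diamond_shear h {a, b} =
      ln (?Y a q - ?Y a b) + ln (?Y a b - ?Y a p) - 2 * ln D +
      (ln (?Y b p - ?Y b a) + ln (?Y b a - ?Y b q) - 2 * ln F)"
    using neq(1) Dp Fp by (simp add: diamond_shear_def Psi_def)
  also have "\<dots> = ln ((?Y a q - ?Y a b) * (?Y a b - ?Y a p) * ((?Y b p - ?Y b a) * (?Y b a - ?Y b q)))
      - 2 * ln (D * F)"
    using pos D F by (simp add: ln_mult)
  \<comment> \<open>Writing \<open>16 / t ^ 4\<close> as a square lets a factor 2 leave the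
    logarithm.\<close>
  also have "\<dots> = ln (4 ^ 2 / (t\<^sup>2) ^ 2) - 2 * ln (D * F)"
    unfolding prod by (simp flip: power_mult)
  also have "\<dots> = 2 * ln (4 / (D * F * t\<^sup>2))"
  proof -
    have "ln (4 ^ 2 / (t\<^sup>2) ^ 2) = 2 * ln (4 / t\<^sup>2)"
      using t ln_realpow[of "4 / t\<^sup>2" 2] by (simp only: power_divide)
    moreover have "ln (4 / (D * F * t\<^sup>2)) = ln (4 / t\<^sup>2) - ln (D * F)"
      using t D F by (simp add: ln_div ln_mult)
    ultimately show ?thesis by simp
  qed
  finally have ds: "diamond_shear h {a, b} = 1 / 2 * ln (4 / (D * F * t\<^sup>2))" by simp
  \<comment> \<open>The numerator is twice the determinant up to a unit factor, which gives the
    length of the chord.\<close>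
  have "a - b = (u * cnj w - w * cnj u) / (cnj u * cnj w)"
    using nz by (simp add: ab vtx_def field_simps)
  also have "u * cnj w - w * cnj u = - 2 * \<i> * of_real (Im (cnj u * w))"
    by (simp add: complex_eq_iff algebra_simps)
  finally have "s = 2 / (norm u * norm w)"
    unfolding s_def uw(2) by (simp add: norm_divide norm_mult)
  then have s: "(norm u)\<^sup>2 * (norm w)\<^sup>2 * s\<^sup>2 = 4"
    using nz by (simp add: power_divide power_mult_distrib)
  show ?thesis
  proof (rule that[OF _ _ Dd Fd])
    show "0 < (norm u)\<^sup>2 / D" "0 < (norm w)\<^sup>2 / F" using nz D F by simp_all
    have "(norm u)\<^sup>2 / D * ((norm w)\<^sup>2 / F) * s\<^sup>2 / t\<^sup>2 = 4 / (D * F * t\<^sup>2)"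
      unfolding s [symmetric] using D F t by (simp add: field_simps)
    then show "diamond_shear h {a, b} = 1 / 2 * ln ((norm u)\<^sup>2 / D * ((norm w)\<^sup>2 / F) * (norm (a - b))\<^sup>2 / (norm (h a - h b))\<^sup>2)"
      using ds by (simp only: s_def t_def)
  qed
qed

end

theorem proposition1p1:
  fixes h :: "complex \<Rightarrow> complex"
  assumes "\<exists>g. homeomorphism (sphere 0 1) (sphere 0 1) h g"
    and "orientation_preserving h"
    and "h (-1) = -1" and "h \<i> = \<i>" and "h 1 = 1"
    and "shear h \<in> shear_P0"
  shows "(\<forall>v\<in>farey_vertices. h field_differentiable (at v within sphere 0 1)) \<and>
    (\<forall>a b. {a, b} \<in> farey_edges \<longrightarrow>
      (\<exists>r::real. r > 0 \<and>
        circle_deriv h a * circle_deriv h b * (a - b)^2 / (h a - h b)^2 = of_real r \<and>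
        diamond_shear h {a, b} = 1 / 2 * ln r) \<and>
      diamond_shear h {a, b} =
        1 / 2 * ln (cmod (circle_deriv h a * circle_deriv h b))
        - ln (cmod ((h a - h b) / (a - b))))"
proof (intro conjI ballI allI impI)
  obtain g where g: "homeomorphism (sphere 0 1) (sphere 0 1) h g" using assms(1) by blast
  interpret circle_embedding h
  proof
    show "norm (h z) = 1" if "norm z = 1" for z
      using homeomorphism_image1[OF g] that by (metis image_eqI mem_sphere_0)
    show "z = w" if "norm z = 1" "norm w = 1" "h z = h w" for z w
      using homeomorphism_apply1[OF g] that by (metis mem_sphere_0)
    show "ccw [h a, h b, h c]" if "ccw [a, b, c]" for a b c
      using assms(2) that by (auto simp: orientation_preserving_def)
  qed
  \<comment> \<open>Every vertex is an end of some edge, so the derivative found along edges covers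
    all vertices.\<close>
  show "h field_differentiable (at v within sphere 0 1)" if "v \<in> farey_vertices" for v
    using farey_vertex_edge[OF that] diamond_shear_edge[OF assms(6)]
    unfolding field_differentiable_def by metis
  fix a b assume e: "{a, b} \<in> farey_edges"
  obtain u w where "unimodular u w" "a = vtx u" "b = vtx w" using farey_edge_form[OF e] by blast
  then have unit: "norm a = 1" "norm b = 1" and neq: "a \<noteq> b"
    using norm_vtx unimodular_nz unimodular_vtx_neq by auto
  have hunit: "norm (h a) = 1" "norm (h b) = 1" using norm_h unit by auto
  have hneq: "h a \<noteq> h b" using inj_h unit neq by blast
  have nz: "a \<noteq> 0" "b \<noteq> 0" "h a \<noteq> 0" "h b \<noteq> 0" using unit hunit by auto
  obtain \<alpha> \<beta> :: real where pos: "0 < \<alpha>" "0 < \<beta>"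
    and d: "(h has_field_derivative h a / a * of_real \<alpha>) (at a within sphere 0 1)"
      "(h has_field_derivative h b / b * of_real \<beta>) (at b within sphere 0 1)"
    and ds: "diamond_shear h {a, b} = 1 / 2 * ln (\<alpha> * \<beta> * (norm (a - b))\<^sup>2 / (norm (h a - h b))\<^sup>2)"
    using diamond_shear_edge[OF assms(6) e] by blast
  define s t where "s = norm (a - b)" and "t = norm (h a - h b)"
  have st: "0 < s" "0 < t" using neq hneq by (simp_all add: s_def t_def)
  note cd = circle_deriv_eq[OF unit(1) d(1)] circle_deriv_eq[OF unit(2) d(2)]
  show "\<exists>r::real. r > 0 \<and>
        circle_deriv h a * circle_deriv h b * (a - b)^2 / (h a - h b)^2 = of_real r \<and>
        diamond_shear h {a, b} = 1 / 2 * ln r"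
  proof (intro exI conjI)
    \<comment> \<open>This goal fixes the witness for \<open>r\<close>: the moduli
      \<open>\<alpha>\<close> and \<open>\<beta>\<close> of the derivatives times the squared ratio
      of the chords.\<close>
    show "0 < \<alpha> * \<beta> * s\<^sup>2 / t\<^sup>2" using pos st by simp
    show "circle_deriv h a * circle_deriv h b * (a - b)^2 / (h a - h b)^2 =
        of_real (\<alpha> * \<beta> * s\<^sup>2 / t\<^sup>2)"
      unfolding cd diff_squared_unit_circle[OF unit] diff_squared_unit_circle[OF hunit]
      using nz st by (simp add: s_def [symmetric] t_def [symmetric] field_simps)
    show "diamond_shear h {a, b} = 1 / 2 * ln (\<alpha> * \<beta> * s\<^sup>2 / t\<^sup>2)"
      using ds by (simp add: s_def t_def)
  qed
  have "cmod (circle_deriv h a * circle_deriv h b) = \<alpha> * \<beta>"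
    unfolding cd using unit hunit pos by (simp add: norm_mult norm_divide)
  moreover have "cmod ((h a - h b) / (a - b)) = t / s" by (simp add: norm_divide s_def t_def)
  moreover have "1 / 2 * ln (\<alpha> * \<beta> * s\<^sup>2 / t\<^sup>2) = 1 / 2 * ln (\<alpha> * \<beta>) - ln (t / s)"
    using pos st by (simp add: ln_mult ln_div ln_realpow)
  ultimately show "diamond_shear h {a, b} =
        1 / 2 * ln (cmod (circle_deriv h a * circle_deriv h b))
        - ln (cmod ((h a - h b) / (a - b)))"
    using ds by (simp add: s_def t_def)
qed

end
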